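(* Let $k\ge2$ be an integer, let $\mathbf{f}=\{f(n)\}_{n\ge0}$ be a $k$-regular sequence of integers, and let $F(x)=\sum_{n\ge0}f(n)x^n\in\mathbb{Z}[[x]]$. Let $L$ be the dimension of the $\mathbb{Q}$-vector space spanned by the $k$-kernel of $\mathbf{f}$. Let $a,b$ be integers with $a\neq 0$, $b\ge2$ and $\log|a|/\log b\in[0,1/(L+2))$. Then $$\mu(F(a/b))\le 39^{(2^6k)^L}.$$
   Context: The $k$-kernel of $\mathbf{f}$ is the set of distinct subsequences $\{f(k^\ell n+r)\}_{n\ge0}$ with $\ell\ge0$ and $0\le r<k^\ell$; $\mathbf{f}$ is $k$-regular if the $\mathbb{Q}$-span of its $k$-kernel is finite-dimensional. The irrationality exponent $\mu(\xi)$ of a real $\xi$ is the supremum of the real $\mu$ such that $0<|\xi-p/q|<q^{-\mu}$ has infinitely many solutions $(p,q)\in\mathbb{Z}\times\mathbb{N}$. *)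

theory Defs
  imports Complex_Main "HOL-Library.Extended_Real" "HOL-Library.Function_Algebras"
begin

definition seq_scale :: "rat \<Rightarrow> (nat \<Rightarrow> rat) \<Rightarrow> nat \<Rightarrow> rat" where
  "seq_scale c g = (\<lambda>n. c * g n)"

global_interpretation rat_seq: vector_space seq_scale
  by unfold_locales (auto simp: seq_scale_def fun_eq_iff algebra_simps)

text \<open>
  Integer sequences are embedded into the rational vector space of all sequences
  \<open>nat \<Rightarrow> rat\<close> (with pointwise operations), so that spans are taken over the rationals.
\<close>

definition k_kernel :: "nat \<Rightarrow> (nat \<Rightarrow> int) \<Rightarrow> (nat \<Rightarrow> rat) set" where
  "k_kernel k f = {\<lambda>n. rat_of_int (f (k ^ l * n + r)) | l r. r < k ^ l}"

definition k_regular :: "nat \<Rightarrow> (nat \<Rightarrow> int) \<Rightarrow> bool" where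
  "k_regular k f \<longleftrightarrow> (\<exists>B. finite B \<and> rat_seq.span B = rat_seq.span (k_kernel k f))"

text \<open>
  The library's \<open>dim\<close> is 0 on infinite-dimensional spaces, so this is the
  true dimension only for k-regular sequences.
\<close>

definition kernel_dim :: "nat \<Rightarrow> (nat \<Rightarrow> int) \<Rightarrow> nat" where
  "kernel_dim k f = rat_seq.dim (rat_seq.span (k_kernel k f))"

text \<open>
  The supremum is taken in the extended reals, since it is infinite for Liouville numbers.
  Solutions are counted as pairs, not necessarily in lowest terms.
\<close>

definition irrationality_exponent :: "real \<Rightarrow> ereal" where
  "irrationality_exponent \<xi> =
     (SUP \<mu> \<in> {\<mu> :: real. infinite {(p :: int, q :: nat). q > 0 \<and>
         0 < \<bar>\<xi> - real_of_int p / real q\<bar> \<and>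
         \<bar>\<xi> - real_of_int p / real q\<bar> < real q powr (- \<mu>)}}. ereal \<mu>)"

definition gen_fun :: "(nat \<Rightarrow> int) \<Rightarrow> real \<Rightarrow> real" where
  "gen_fun f x = (\<Sum>n. real_of_int (f n) * x ^ n)"

end

(*
A basis g_0, ..., g_{L-1} of the span of the kernel can be chosen inside the kernel. Its vector G of
generating functions satisfies a Mahler system G(x) = A(x) G(x^k) with rational polynomial entries, so
xi = F(a/b) equals rho_n . G(y_n) with y_n = (a/b)^(k^n) and a row vector rho_n that grows at most
exponentially in n. Let Q, P_j be simultaneous Pade polynomials of degree at most M = L(L+3) with
Q G_j - P_j = O(x^N), N = (L+2)^2. After clearing denominators, q_n = Q(y_n) and p_n = rho_n . P(y_n)
become integers with |q_n xi - p_n| <= b^(-k^n) for large n; this is where |a|^(L+2) < b enters.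

No zero estimate is needed to see that the approximations are distinct. The L + 2 polynomial vectors
describing (q_{n+i}, p_{n+i}), 0 <= i <= L+1, in terms of rho_n and y_n have only L + 1 components, so
they are linearly dependent over the polynomials. This is a recurrence of order at most L + 1, and if
p_j/q_j took one value for L + 1 consecutive large j it would be constant from there on, hence equal to xi.
The result is mu(xi) <= 1 + (L+1)(L+2) k^(L+1), well below the stated bound.
*)
theory Submission
  imports Defs "HOL-Analysis.Analysis"
begin

section \<open>Elimination, denominators and a growth comparison\<close>

text \<open>Gaussian elimination without division, by induction on the number of equations. It is
  stated over an integral domain because it is applied both to integers (Pade coefficients) and to
  real polynomials (the recurrence between approximations).\<close>

lemma homogeneous_system_nontrivial_solution:
  fixes M :: "'i \<Rightarrow> nat \<Rightarrow> 'a::idom"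
  assumes "finite I" "m < card I"
  shows "\<exists>c. (\<exists>i\<in>I. c i \<noteq> 0) \<and> (\<forall>j<m. (\<Sum>i\<in>I. c i * M i j) = 0)"
  using assms
proof (induction m arbitrary: I M)
  case 0
  then have "I \<noteq> {}" by auto
  then show ?case by (intro exI[of _ "\<lambda>_. 1"]) auto
next
  case (Suc m)
  show ?case
  proof (cases "\<forall>i\<in>I. M i m = 0")
    case True
    from Suc.IH[of I M] Suc.prems obtain c
      where c: "\<exists>i\<in>I. c i \<noteq> 0" "\<forall>j<m. (\<Sum>i\<in>I. c i * M i j) = 0" by auto
    have "(\<Sum>i\<in>I. c i * M i j) = 0" if "j < Suc m" for j
      using that c(2) True by (cases "j = m") auto
    with c(1) show ?thesis by blast
  next
    case False
    then obtain i0 where i0: "i0 \<in> I" "M i0 m \<noteq> 0" by blast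
    define J where "J = I - {i0}"
    have J: "finite J" "m < card J" "i0 \<notin> J" "I = insert i0 J"
      using Suc.prems i0 by (auto simp: J_def)
    \<comment> \<open>Cross-multiplication with the pivot \<open>M i0 m\<close> makes column
      \<open>m\<close> of \<open>M'\<close> vanish, so the induction hypothesis only has to handle
      the first \<open>m\<close> columns.\<close>
    define M' where "M' = (\<lambda>i j. M i0 m * M i j - M i m * M i0 j)"
    from Suc.IH[OF J(1,2), of M'] obtain c where
      c: "\<exists>i\<in>J. c i \<noteq> 0" "\<forall>j<m. (\<Sum>i\<in>J. c i * M' i j) = 0" by auto
    \<comment> \<open>The coefficient at \<open>i0\<close> is forced by the elimination. The others
      are scaled by the nonzero pivot, so in a domain a nonzero one stays nonzero.\<close>
    define c' where
      "c' = (\<lambda>i. if i = i0 then - (\<Sum>i\<in>J. c i * M i m) else c i * M i0 m)"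
    have sum: "(\<Sum>i\<in>I. c' i * M i j) = (\<Sum>i\<in>J. c i * M' i j)" for j
    proof -
      have "(\<Sum>i\<in>I. c' i * M i j) = c' i0 * M i0 j + (\<Sum>i\<in>J. c' i * M i j)"
        using J by simp
      also have "(\<Sum>i\<in>J. c' i * M i j) = (\<Sum>i\<in>J. c i * M i0 m * M i j)"
        using J by (intro sum.cong) (auto simp: c'_def)
      also have "c' i0 * M i0 j = (\<Sum>i\<in>J. - (c i * M i m * M i0 j))"
        by (simp add: c'_def sum_distrib_right sum_negf)
      also have "\<dots> + (\<Sum>i\<in>J. c i * M i0 m * M i j) = (\<Sum>i\<in>J. c i * M' i j)"
        unfolding sum.distrib[symmetric] by (intro sum.cong) (auto simp: M'_def algebra_simps)
      finally show ?thesis .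
    qed
    have "M' i m = 0" for i by (simp add: M'_def mult.commute)
    then have "(\<Sum>i\<in>I. c' i * M i j) = 0" if "j < Suc m" for j
      using that c(2) by (cases "j = m") (auto simp: sum)
    moreover have "\<exists>i\<in>I. c' i \<noteq> 0"
      using c(1) i0(2) J by (force simp: c'_def)
    ultimately show ?thesis by blast
  qed
qed

lemma finite_common_denominator:
  fixes S :: "rat set"
  assumes "finite S"
  shows "\<exists>D::int. D > 0 \<and> (\<forall>x\<in>S. of_int D * x \<in> \<int>)"
  using assms
proof induction
  case empty
  show ?case by (intro exI[of _ 1]) auto
next
  case (insert x S)
  then obtain D :: int where D: "D > 0" "\<forall>x\<in>S. of_int D * x \<in> \<int>" by blast
  obtain p q where pq: "x = of_int p / of_int q" "q > 0"
    by (metis quotient_of_denom_pos quotient_of_div surj_pair)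
  have "of_int (D * q) * x = of_int (D * p)" using pq by simp
  then have "of_int (D * q) * x \<in> \<int>" by (metis Ints_of_int)
  moreover have "of_int (D * q) * y \<in> \<int>" if "y \<in> S" for y
  proof -
    have "of_int (D * q) * y = of_int q * (of_int D * y)" by simp
    with D that show ?thesis by (metis Ints_mult Ints_of_int)
  qed
  ultimately show ?case using D pq by (intro exI[of _ "D * q"]) auto
qed

text \<open>Since k is at least 2, it suffices to compare logarithms with \<open>2 ^ n\<close>: the
  logarithm of the exponential factor is linear in n, hence negligible against
  \<open>2 ^ n\<close>.\<close>

lemma eventually_power_times_double_power_le:
  fixes C \<theta> K :: real and k :: nat
  assumes "k \<ge> 2" "0 \<le> \<theta>" "\<theta> < 1" "C \<ge> 1" "K \<ge> 0"
  shows "eventually (\<lambda>n. K * C ^ n * \<theta> ^ (k ^ n) \<le> 1) sequentially"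
proof -
  \<comment> \<open>The maxima \<open>t\<close> and, below, \<open>K'\<close> keep the logarithms
    meaningful when \<open>\<theta>\<close> or \<open>K\<close> is 0.\<close>
  define t where "t = max \<theta> (1/2)"
  have t: "0 < t" "t < 1" "\<theta> \<le> t" using assms by (auto simp: t_def)
  define d where "d = - ln t"
  have d: "d > 0" using t by (simp add: d_def)
  define K' where "K' = max K 1"
  have K': "K' > 0" "K \<le> K'" by (auto simp: K'_def)
  have "(\<lambda>n. (ln K' + real n * ln C) / 2 ^ n) \<longlonglongrightarrow> 0"
  proof -
    have "(\<lambda>n. ln K' * (1/2) ^ n + ln C * (real n * (1/2) ^ n)) \<longlonglongrightarrow> ln K' * 0 + ln C * 0"
      by (intro tendsto_intros LIMSEQ_power_zero powser_times_n_limit_0) auto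
    moreover have "ln K' * (1/2) ^ n + ln C * (real n * (1/2) ^ n) = (ln K' + real n * ln C) / 2 ^ n" for n
      by (simp add: power_divide add_divide_distrib)
    ultimately show ?thesis by simp
  qed
  then have "eventually (\<lambda>n. (ln K' + real n * ln C) / 2 ^ n < d) sequentially"
    using d order_tendstoD(2) by blast
  then show ?thesis
  proof eventually_elim
    case (elim n)
    then have "ln K' + real n * ln C \<le> d * 2 ^ n" by (simp add: field_simps)
    then have "exp (ln K' + real n * ln C) \<le> exp (d * 2 ^ n)" by simp
    moreover have "exp (ln K' + real n * ln C) = K' * C ^ n"
      using K' assms by (simp add: exp_add exp_of_nat_mult)
    moreover have "exp (d * 2 ^ n) = 1 / t ^ (2 ^ n)"
    proof -
      have "d * 2 ^ n = - (real (2 ^ n) * ln t)" by (simp add: d_def)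
      then show ?thesis
        using t by (simp only: exp_minus exp_of_nat_mult exp_ln inverse_eq_divide)
    qed
    ultimately have *: "K' * C ^ n * t ^ (2 ^ n) \<le> 1" using t by (simp add: field_simps)
    have "\<theta> ^ (k ^ n) \<le> t ^ (k ^ n)" using t assms by (intro power_mono) auto
    also have "\<dots> \<le> t ^ (2 ^ n)" using t assms by (intro power_decreasing power_mono) auto
    finally have "K * C ^ n * \<theta> ^ (k ^ n) \<le> K' * C ^ n * t ^ (2 ^ n)"
      using K' assms t by (intro mult_mono) auto
    with * show ?case by simp
  qed
qed

section \<open>Upper bounds for the irrationality exponent\<close>

lemma finite_approximations_bounded_denominator:
  fixes \<xi> \<mu> :: real
  assumes "\<mu> \<ge> 0"
  shows "finite {(p :: int, q :: nat). 0 < q \<and> q \<le> m \<and>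
    \<bar>\<xi> - real_of_int p / real q\<bar> < real q powr (- \<mu>)}"
proof -
  define R where "R = \<lceil>real m * (\<bar>\<xi>\<bar> + 1)\<rceil>"
  have "{(p :: int, q :: nat). 0 < q \<and> q \<le> m \<and>
    \<bar>\<xi> - real_of_int p / real q\<bar> < real q powr (- \<mu>)} \<subseteq> {-R..R} \<times> {..m}"
  proof (rule subsetI, elim CollectE case_prodE conjE, simp only:)
    fix p :: int and q :: nat
    assume q: "0 < q" "q \<le> m" and "\<bar>\<xi> - real_of_int p / real q\<bar> < real q powr (- \<mu>)"
    moreover have "real q powr (- \<mu>) \<le> 1"
      using q assms by (simp add: powr_minus_divide ge_one_powr_ge_zero)
    ultimately have "\<bar>real_of_int p / real q\<bar> \<le> \<bar>\<xi>\<bar> + 1" by linarith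
    then have "\<bar>real_of_int p\<bar> \<le> real q * (\<bar>\<xi>\<bar> + 1)" using q by (simp add: field_simps abs_if split: if_splits)
    also have "\<dots> \<le> real m * (\<bar>\<xi>\<bar> + 1)" using q by (intro mult_right_mono) auto
    also have "\<dots> \<le> real_of_int R" by (simp add: R_def)
    finally have "\<bar>p\<bar> \<le> R" by linarith
    with q show "(p, q) \<in> {-R..R} \<times> {..m}" by auto
  qed
  then show ?thesis by (rule finite_subset) auto
qed

text \<open>Only large denominators need a lower bound: for \<open>\<mu>\<close> > B >= 0 the
  solutions with denominator at most m have bounded numerators, so they are finite in
  number.\<close>

lemma irrationality_exponent_leI:
  fixes \<xi> B :: real
  assumes "B \<ge> 0"
    and bound: "\<And>\<mu>. \<mu> > B \<Longrightarrow> \<exists>m. \<forall>p::int. \<forall>q::nat. q > m \<longrightarrow> 0 < \<bar>\<xi> - real_of_int p / real q\<bar> \<longrightarrow>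
           real q powr (- \<mu>) \<le> \<bar>\<xi> - real_of_int p / real q\<bar>"
  shows "irrationality_exponent \<xi> \<le> ereal B"
  unfolding irrationality_exponent_def
proof (rule SUP_least, clarify)
  fix \<mu> :: real
  assume inf: "infinite {(p :: int, q :: nat). q > 0 \<and> 0 < \<bar>\<xi> - real_of_int p / real q\<bar> \<and>
         \<bar>\<xi> - real_of_int p / real q\<bar> < real q powr (- \<mu>)}"
  show "ereal \<mu> \<le> ereal B"
  proof (rule ccontr)
    assume "\<not> ereal \<mu> \<le> ereal B"
    then have \<mu>: "\<mu> > B" by simp
    from bound[OF this] obtain m where
      m: "\<And>(p::int) q::nat. q > m \<Longrightarrow> 0 < \<bar>\<xi> - real_of_int p / real q\<bar> \<Longrightarrow>
           real q powr (- \<mu>) \<le> \<bar>\<xi> - real_of_int p / real q\<bar>" by blast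
    have "{(p :: int, q :: nat). q > 0 \<and> 0 < \<bar>\<xi> - real_of_int p / real q\<bar> \<and>
         \<bar>\<xi> - real_of_int p / real q\<bar> < real q powr (- \<mu>)} \<subseteq> {(p :: int, q :: nat). 0 < q \<and> q \<le> m \<and>
          \<bar>\<xi> - real_of_int p / real q\<bar> < real q powr (- \<mu>)}"
      using m by (clarify, meson leD leI)
    then have "finite {(p :: int, q :: nat). q > 0 \<and> 0 < \<bar>\<xi> - real_of_int p / real q\<bar> \<and>
         \<bar>\<xi> - real_of_int p / real q\<bar> < real q powr (- \<mu>)}"
      by (rule finite_subset) (use \<mu> assms(1) in \<open>intro finite_approximations_bounded_denominator, simp\<close>)
    with inf show False by simp
  qed
qed

text \<open>Serves the degenerate case of kernel dimension 0, where F vanishes. A nonzero p/q has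
  absolute value at least 1/q.\<close>

lemma irrationality_exponent_zero_le: "irrationality_exponent 0 \<le> 1"
  unfolding one_ereal_def
proof (rule irrationality_exponent_leI)
  fix \<mu> :: real assume \<mu>: "\<mu> > 1"
  show "\<exists>m. \<forall>p::int. \<forall>q::nat. q > m \<longrightarrow> 0 < \<bar>0 - real_of_int p / real q\<bar> \<longrightarrow>
           real q powr (- \<mu>) \<le> \<bar>0 - real_of_int p / real q\<bar>"
  proof (intro exI[of _ 0] allI impI)
    fix p :: int and q :: nat
    assume q: "0 < q" and p: "0 < \<bar>0 - real_of_int p / real q\<bar>"
    have "real q powr (- \<mu>) \<le> real q powr (-1)" using q \<mu> by (intro powr_mono) auto
    also have "\<dots> = 1 / real q" using q by (simp add: powr_minus_divide)
    also have "\<dots> \<le> \<bar>real_of_int p\<bar> / real q"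
    proof (rule divide_right_mono)
      have "p \<noteq> 0" using p by auto
      then show "1 \<le> \<bar>real_of_int p\<bar>" by linarith
    qed simp
    finally show "real q powr (- \<mu>) \<le> \<bar>0 - real_of_int p / real q\<bar>" using q by simp
  qed
qed auto

text \<open>Given p/q, take the least m with 2q < b^(k^m) and an index j in the window starting at m
  with p qh_j - q ph_j nonzero. This integer equals q (qh_j \<xi> - ph_j) - qh_j (q \<xi> - p). The
  first term is at most 1/2, so the second is at least 1/2, and an upper bound for |qh_j| in terms
  of q keeps p/q away from \<xi>.\<close>

lemma irrationality_exponent_le_of_approximations:
  fixes \<xi> b :: real and qh ph :: "nat \<Rightarrow> int" and k H l :: nat
  assumes b: "b > 1" and k: "k \<ge> 2"
    and err: "\<And>n. n \<ge> n0 \<Longrightarrow> \<bar>real_of_int (qh n) * \<xi> - real_of_int (ph n)\<bar> * b ^ (k ^ n) \<le> 1"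
    and size: "\<And>n. n \<ge> n0 \<Longrightarrow> \<bar>real_of_int (qh n)\<bar> \<le> b ^ (H * k ^ n)"
    and indep: "\<And>n p q. n \<ge> n0 \<Longrightarrow> q > 0 \<Longrightarrow> \<xi> \<noteq> real_of_int p / real q \<Longrightarrow>
        \<exists>j\<in>{n..n+l}. p * qh j \<noteq> int q * ph j"
  shows "irrationality_exponent \<xi> \<le> ereal (1 + real (H * k ^ (l + 1)))"
proof (rule irrationality_exponent_leI)
  define E where "E = H * k ^ (l + 1)"
  fix \<mu> assume "\<mu> > 1 + real (H * k ^ (l + 1))"
  then have \<mu>: "1 + real E - \<mu> < 0" by (simp add: E_def)
  have "((\<lambda>q. real q powr (1 + real E - \<mu>)) \<longlongrightarrow> 0) sequentially"
    by (rule tendsto_neg_powr[OF \<mu> filterlim_real_sequentially])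
  \<comment> \<open>The threshold is chosen so that multiplying by 2^E leaves less than 1/2, which
    contradicts the second term of the splitting.\<close>
  then have "eventually (\<lambda>q. real q powr (1 + real E - \<mu>) < 1 / (2 * 2 ^ E)) sequentially"
    by (rule order_tendstoD) auto
  then obtain m0 where m0: "\<And>q. q \<ge> m0 \<Longrightarrow> real q powr (1 + real E - \<mu>) < 1 / (2 * 2 ^ E)"
    by (auto simp: eventually_sequentially)
  \<comment> \<open>Denominators beyond \<open>m1\<close> force the least index m above
    \<open>n0\<close>; in particular m has a predecessor.\<close>
  define m1 where "m1 = nat \<lceil>b ^ (k ^ n0)\<rceil>"
  show "\<exists>m. \<forall>p::int. \<forall>q::nat. q > m \<longrightarrow> 0 < \<bar>\<xi> - real_of_int p / real q\<bar> \<longrightarrow>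
           real q powr (- \<mu>) \<le> \<bar>\<xi> - real_of_int p / real q\<bar>"
  proof (intro exI[of _ "max m0 m1"] allI impI)
    fix p :: int and q :: nat
    assume q: "max m0 m1 < q" and ne: "0 < \<bar>\<xi> - real_of_int p / real q\<bar>"
    then have q0: "q > 0" and q1: "b ^ (k ^ n0) \<le> real q"
      by (auto simp: m1_def nat_less_iff) linarith
    show "real q powr (- \<mu>) \<le> \<bar>\<xi> - real_of_int p / real q\<bar>"
    proof (rule ccontr)
      assume "\<not> ?thesis"
      then have close: "\<bar>\<xi> - real_of_int p / real q\<bar> < real q powr (- \<mu>)" by simp
      obtain N where N: "2 * real q < b ^ N" using real_arch_pow[OF b] by blast
      have "N \<le> k ^ N" using k less_exp[of N] power_mono[of 2 k N] by linarith
      then have "b ^ N \<le> b ^ (k ^ N)" using b by (intro power_increasing) auto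
      with N have ex: "2 * real q < b ^ (k ^ N)" by linarith
      define m where "m = (LEAST m. 2 * real q < b ^ (k ^ m))"
      have m: "2 * real q < b ^ (k ^ m)" unfolding m_def using ex by (rule LeastI)
      have mn0: "n0 < m"
      proof (rule ccontr)
        assume "\<not> n0 < m"
        then have "b ^ (k ^ m) \<le> b ^ (k ^ n0)"
          using b k by (intro power_increasing) auto
        with m q1 q0 show False by simp
      qed
      then obtain m' where m': "m = Suc m'" by (cases m) auto
      \<comment> \<open>Minimality of m bounds the preceding power by 2q. As j is at most m' + l +
        1, this gives |qh_j| <= (2q)^E with E = H k^(l+1).\<close>
      have le: "b ^ (k ^ m') \<le> 2 * real q"
        using not_less_Least[of m' "\<lambda>m. 2 * real q < b ^ (k ^ m)"] m' by (simp add: m_def not_less)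
      from indep[of m q p] mn0 q0 ne obtain j where
        j: "m \<le> j" "j \<le> m + l" "p * qh j \<noteq> int q * ph j" by auto
      have jn0: "j \<ge> n0" using j mn0 by simp
      have "real_of_int 1 \<le> real_of_int \<bar>p * qh j - int q * ph j\<bar>"
        using j(3) by (subst of_int_le_iff) linarith
      also have "real_of_int \<bar>p * qh j - int q * ph j\<bar> =
          \<bar>real q * (real_of_int (qh j) * \<xi> - real_of_int (ph j))
           - real_of_int (qh j) * (real q * (\<xi> - real_of_int p / real q))\<bar>"
        using q0 by (simp add: algebra_simps)
      also have "\<dots> \<le> real q * \<bar>real_of_int (qh j) * \<xi> - real_of_int (ph j)\<bar>
           + \<bar>real_of_int (qh j)\<bar> * (real q * \<bar>\<xi> - real_of_int p / real q\<bar>)"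
        by (rule order_trans[OF abs_triangle_ineq4]) (simp add: abs_mult)
      finally have one: "1 \<le> real q * \<bar>real_of_int (qh j) * \<xi> - real_of_int (ph j)\<bar>
           + \<bar>real_of_int (qh j)\<bar> * (real q * \<bar>\<xi> - real_of_int p / real q\<bar>)" by simp
      have "2 * real q * \<bar>real_of_int (qh j) * \<xi> - real_of_int (ph j)\<bar>
          \<le> b ^ (k ^ j) * \<bar>real_of_int (qh j) * \<xi> - real_of_int (ph j)\<bar>"
      proof (rule mult_right_mono)
        have "b ^ (k ^ m) \<le> b ^ (k ^ j)" using b k j by (intro power_increasing) auto
        with m show "2 * real q \<le> b ^ (k ^ j)" by simp
      qed auto
      also have "\<dots> \<le> 1" using err[OF jn0] by (simp add: mult.commute)
      finally have half: "real q * \<bar>real_of_int (qh j) * \<xi> - real_of_int (ph j)\<bar> \<le> 1/2" by simp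
      have "\<bar>real_of_int (qh j)\<bar> \<le> b ^ (H * k ^ j)" by (rule size[OF jn0])
      also have "\<dots> \<le> b ^ (k ^ m' * E)"
      proof (rule power_increasing)
        have "k ^ j \<le> k ^ (m' + (l + 1))" using k j m' by (intro power_increasing) auto
        then have "H * k ^ j \<le> H * k ^ (m' + (l + 1))" by (rule mult_left_mono) simp
        also have "\<dots> = k ^ m' * E" by (simp add: E_def power_add)
        finally show "H * k ^ j \<le> k ^ m' * E" .
      qed (use b in simp)
      also have "\<dots> = (b ^ (k ^ m')) ^ E" by (simp add: power_mult)
      also have "\<dots> \<le> (2 * real q) ^ E" using le b by (intro power_mono) auto
      finally have "\<bar>real_of_int (qh j)\<bar> \<le> 2 ^ E * real q ^ E" by (simp add: power_mult_distrib)
      then have "\<bar>real_of_int (qh j)\<bar> * (real q * \<bar>\<xi> - real_of_int p / real q\<bar>)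
          \<le> (2 ^ E * real q ^ E) * (real q * real q powr (- \<mu>))"
        using close by (intro mult_mono) auto
      also have "\<dots> = 2 ^ E * real q powr (1 + real E - \<mu>)"
      proof -
        have "real q powr (1 + real E - \<mu>) = real q powr (1 + real E + - \<mu>)" by simp
        also have "\<dots> = real q * real q ^ E * real q powr (- \<mu>)"
          unfolding powr_add using q0 by (simp add: powr_realpow)
        finally show ?thesis by simp
      qed
      also have "\<dots> < 2 ^ E * (1 / (2 * 2 ^ E))"
        using m0[of q] q by (intro mult_strict_left_mono) auto
      also have "\<dots> = 1/2" by simp
      finally show False using one half by linarith
    qed
  qed
qed auto


section \<open>Values of polynomials\<close>

lemma poly_scaled_in_Ints:
  fixes p :: "real poly"
  assumes "\<And>i. coeff p i \<in> \<int>" "degree p \<le> m" "b \<noteq> 0"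
  shows "real_of_int b ^ m * poly p (real_of_int a / real_of_int b) \<in> \<int>"
proof -
  have "real_of_int b ^ m * poly p (real_of_int a / real_of_int b) =
      (\<Sum>i\<le>degree p. coeff p i * real_of_int (a ^ i * b ^ (m - i)))"
    unfolding poly_altdef sum_distrib_left
  proof (rule sum.cong)
    fix i assume "i \<in> {..degree p}"
    then have "real_of_int b ^ m = real_of_int b ^ i * real_of_int b ^ (m - i)"
      using assms(2) by (simp flip: power_add)
    then show "real_of_int b ^ m * (coeff p i * (real_of_int a / real_of_int b) ^ i) =
        coeff p i * real_of_int (a ^ i * b ^ (m - i))"
      using assms(3) by (simp add: power_divide)
  qed simp
  also have "\<dots> \<in> \<int>" using assms(1) by (intro Ints_sum Ints_mult) auto
  finally show ?thesis .
qed

lemma abs_poly_le_sum_abs_coeff: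
  fixes p :: "real poly"
  assumes "\<bar>x\<bar> \<le> 1"
  shows "\<bar>poly p x\<bar> \<le> (\<Sum>i\<le>degree p. \<bar>coeff p i\<bar>)"
  unfolding poly_altdef
proof (rule order_trans[OF sum_abs sum_mono])
  fix i
  have "\<bar>x\<bar> ^ i \<le> 1" using assms by (intro power_le_one) auto
  then show "\<bar>coeff p i * x ^ i\<bar> \<le> \<bar>coeff p i\<bar>"
    by (simp add: abs_mult power_abs mult_left_le)
qed

text \<open>The points x^(k^n) are pairwise distinct, and a nonzero polynomial has only finitely
  many roots, so only finitely many n are bad.\<close>

lemma eventually_poly_iterated_power_nonzero:
  fixes c :: "real poly" and k :: nat
  assumes "c \<noteq> 0" "0 < \<bar>x\<bar>" "\<bar>x\<bar> < 1" "k \<ge> 2"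
  shows "eventually (\<lambda>n. poly c (x ^ (k ^ n)) \<noteq> 0) sequentially"
proof -
  have inj: "inj (\<lambda>n. x ^ (k ^ n))"
  proof (rule injI)
    fix m n assume "x ^ (k ^ m) = x ^ (k ^ n)"
    then have eq: "\<bar>x\<bar> ^ (k ^ m) = \<bar>x\<bar> ^ (k ^ n)" by (metis power_abs)
    have "k ^ m = k ^ n"
    proof (rule ccontr)
      assume "k ^ m \<noteq> k ^ n"
      then consider "k ^ m < k ^ n" | "k ^ n < k ^ m" by linarith
      then show False
        using eq power_strict_decreasing[of "k ^ m" "k ^ n" "\<bar>x\<bar>"]
          power_strict_decreasing[of "k ^ n" "k ^ m" "\<bar>x\<bar>"] assms by cases auto
    qed
    then show "m = n" using assms(4) by (simp add: power_inject_exp)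
  qed
  have "finite ((\<lambda>n. x ^ (k ^ n)) -` {y. poly c y = 0})"
    using poly_roots_finite[OF assms(1)] inj by (rule finite_vimageI)
  then have "finite {n. \<not> poly c (x ^ (k ^ n)) \<noteq> 0}" by (simp add: vimage_def)
  then show ?thesis unfolding cofinite_eq_sequentially[symmetric] eventually_cofinite .
qed

section \<open>Mahler systems: growth, convergence and functional equation\<close>

text \<open>The rational matrices that express the k sections of the sequences \<open>g i\<close>
  through these sequences are stored as integer matrices \<open>A r\<close> over one denominator
  \<open>D\<close>.\<close>

locale mahler_system =
  fixes k L :: nat and g :: "nat \<Rightarrow> nat \<Rightarrow> int" and A :: "nat \<Rightarrow> nat \<Rightarrow> nat \<Rightarrow> int" and D :: int
  assumes k_ge_2: "k \<ge> 2" and D_pos: "D > 0"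
    and section_rec:
      "\<And>i r n. i < L \<Longrightarrow> r < k \<Longrightarrow> D * g i (k * n + r) = (\<Sum>j<L. A r i j * g j n)"
begin

definition G :: "nat \<Rightarrow> real \<Rightarrow> real" where
  "G i x = (\<Sum>n. real_of_int (g i n) * x ^ n)"

text \<open>The polynomial Mahler matrix, with G(x) = T(x) G(x^k). Its coefficient of x^r is
  \<open>A r\<close> divided by \<open>D\<close>, so every entry has degree below k.\<close>

definition T :: "nat \<Rightarrow> nat \<Rightarrow> real poly" where
  "T i j = (\<Sum>r<k. monom (real_of_int (A r i j) / real_of_int D) r)"

lemma poly_T: "poly (T i j) x = (\<Sum>r<k. real_of_int (A r i j) / real_of_int D * x ^ r)"
  by (simp add: T_def poly_sum poly_monom)

text \<open>Passing from index m to km + r multiplies a bound by at most the constant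
  \<open>E\<close>. Meanwhile s^m grows to at least s^(m0 + m), and \<open>m0\<close> is chosen so
  that s^m0 exceeds \<open>E\<close>.\<close>

lemma subexponential_growth:
  fixes s :: real
  assumes s: "s > 1"
  shows "\<exists>C\<ge>0. \<forall>i<L. \<forall>n. \<bar>real_of_int (g i n)\<bar> \<le> C * s ^ n"
proof -
  define E where "E = (\<Sum>i<L. \<Sum>r<k. \<Sum>j<L. \<bar>real_of_int (A r i j)\<bar>)"
  have step: "\<bar>real_of_int (g i (k * n + r))\<bar> \<le> E * B"
    if "i < L" "r < k" "B \<ge> 0" "\<And>j. j < L \<Longrightarrow> \<bar>real_of_int (g j n)\<bar> \<le> B" for i r n B
  proof -
    have "\<bar>real_of_int (g i (k * n + r))\<bar> \<le> real_of_int D * \<bar>real_of_int (g i (k * n + r))\<bar>"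
      using D_pos by (simp add: mult_le_cancel_right1)
    also have "\<dots> = \<bar>real_of_int (D * g i (k * n + r))\<bar>"
      using D_pos by (simp add: abs_mult)
    also have "\<dots> \<le> (\<Sum>j<L. \<bar>real_of_int (A r i j * g j n)\<bar>)"
      unfolding section_rec[OF that(1,2)] of_int_sum by (rule sum_abs)
    also have "\<dots> \<le> (\<Sum>j<L. \<bar>real_of_int (A r i j)\<bar> * B)"
      using that by (intro sum_mono) (auto simp: abs_mult intro!: mult_left_mono)
    also have "\<dots> = (\<Sum>j<L. \<bar>real_of_int (A r i j)\<bar>) * B" by (simp add: sum_distrib_right)
    also have "(\<Sum>j<L. \<bar>real_of_int (A r i j)\<bar>) \<le> (\<Sum>r<k. \<Sum>j<L. \<bar>real_of_int (A r i j)\<bar>)"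
      using that by (intro member_le_sum) (auto intro: sum_nonneg)
    also have "\<dots> \<le> E"
      unfolding E_def using that
      by (intro member_le_sum[of i _ "\<lambda>i. \<Sum>r<k. \<Sum>j<L. \<bar>real_of_int (A r i j)\<bar>"])
        (auto intro: sum_nonneg)
    finally show ?thesis using that by (simp add: mult_right_mono)
  qed
  obtain m0 where m0: "E < s ^ m0" using real_arch_pow[OF s] by blast
  \<comment> \<open>For n >= \<open>n0\<close> the quotient m = n div k is at least m0 + 1, so n >=
    2m gives both m < n and m0 + m <= n.\<close>
  define n0 where "n0 = k * (m0 + 1)"
  define C where "C = (\<Sum>i<L. \<Sum>n<n0. \<bar>real_of_int (g i n)\<bar>)"
  have C: "C \<ge> 0" unfolding C_def by (intro sum_nonneg) auto
  have "\<forall>i<L. \<bar>real_of_int (g i n)\<bar> \<le> C * s ^ n" for n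
  proof (induction n rule: less_induct)
    case (less n)
    show ?case
    proof (intro allI impI)
      fix i assume i: "i < L"
      show "\<bar>real_of_int (g i n)\<bar> \<le> C * s ^ n"
      proof (cases "n < n0")
        case True
        have "\<bar>real_of_int (g i n)\<bar> \<le> (\<Sum>n<n0. \<bar>real_of_int (g i n)\<bar>)"
          using True by (intro member_le_sum[of n _ "\<lambda>n. \<bar>real_of_int (g i n)\<bar>"]) auto
        also have "\<dots> \<le> C"
          unfolding C_def using i
          by (intro member_le_sum[of i _ "\<lambda>i. \<Sum>n<n0. \<bar>real_of_int (g i n)\<bar>"]) (auto intro: sum_nonneg)
        also have "\<dots> \<le> C * s ^ n" using C s by (simp add: mult_le_cancel_left1)
        finally show ?thesis .
      next
        case False
        define m where "m = n div k"
        have n: "n = k * m + n mod k" by (simp add: m_def)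
        have m: "m0 + 1 \<le> m"
          unfolding m_def using False k_ge_2 by (simp add: n0_def less_eq_div_iff_mult_less_eq mult.commute)
        have "2 * m \<le> k * m" using k_ge_2 by (rule mult_right_mono) simp
        then have mn: "m < n" "m0 + m \<le> n" using m n by linarith+
        have "\<bar>real_of_int (g i (k * m + n mod k))\<bar> \<le> E * (C * s ^ m)"
          using i k_ge_2 C s less.IH[OF mn(1)] by (intro step) auto
        also have "\<dots> \<le> s ^ m0 * (C * s ^ m)" using m0 C s by (intro mult_right_mono) auto
        also have "\<dots> = C * s ^ (m0 + m)" by (simp add: power_add)
        also have "\<dots> \<le> C * s ^ n" using mn C s by (intro mult_left_mono power_increasing) auto
        finally show ?thesis using n by simp
      qed
    qed
  qed
  with C show ?thesis by blast
qed

lemma summable_abs_G: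
  assumes "\<bar>x\<bar> < 1" "i < L"
  shows "summable (\<lambda>n. \<bar>real_of_int (g i n) * x ^ n\<bar>)"
proof -
  \<comment> \<open>A rate above 1 with s|x| still below 1, so that the growth bound yields a
    convergent geometric majorant.\<close>
  define s where "s = 2 / (1 + \<bar>x\<bar>)"
  have s: "s > 1" "0 \<le> s * \<bar>x\<bar>" "s * \<bar>x\<bar> < 1" using assms(1) by (auto simp: s_def field_simps)
  from subexponential_growth[OF s(1)] assms(2) obtain C where
    C: "\<And>n. \<bar>real_of_int (g i n)\<bar> \<le> C * s ^ n" by blast
  show ?thesis
  proof (rule summable_comparison_test)
    show "summable (\<lambda>n. C * (s * \<bar>x\<bar>) ^ n)"
      using s by (intro summable_mult summable_geometric) auto
    have "\<bar>real_of_int (g i n) * x ^ n\<bar> \<le> C * (s * \<bar>x\<bar>) ^ n" for n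
      using mult_right_mono[OF C[of n], of "\<bar>x\<bar> ^ n"]
      by (simp add: abs_mult power_abs power_mult_distrib mult.assoc)
    then show "\<exists>N. \<forall>n\<ge>N. norm \<bar>real_of_int (g i n) * x ^ n\<bar> \<le> C * (s * \<bar>x\<bar>) ^ n" by auto
  qed
qed

lemma G_sums:
  assumes "\<bar>x\<bar> < 1" "i < L"
  shows "(\<lambda>n. real_of_int (g i n) * x ^ n) sums G i x"
  unfolding G_def by (rule summable_sums[OF summable_rabs_cancel[OF summable_abs_G[OF assms]]])

lemma abs_power_less_one: "\<bar>x ^ (k ^ n)\<bar> < 1" if "\<bar>x :: real\<bar> < 1" for x n
  using that k_ge_2 by (simp add: power_abs power_less_one_iff)

text \<open>Group the series into blocks of k consecutive terms; \<open>section_rec\<close> turns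
  the n-th block into a combination of the n-th terms of the G_j at x^k.\<close>

lemma G_functional_equation:
  assumes x: "\<bar>x\<bar> < 1" and i: "i < L"
  shows "G i x = (\<Sum>j<L. poly (T i j) x * G j (x ^ k))"
proof -
  have xk: "\<bar>x ^ k\<bar> < 1" using abs_power_less_one[OF x, of 1] by simp
  have block: "(\<Sum>m\<in>{n*k..<n*k+k}. real_of_int (g i m) * x ^ m) =
      (\<Sum>j<L. poly (T i j) x * (real_of_int (g j n) * (x ^ k) ^ n))" for n
  proof -
    have "(\<Sum>m\<in>{n*k..<n*k+k}. real_of_int (g i m) * x ^ m) =
        (\<Sum>r<k. real_of_int (g i (k * n + r)) * x ^ (k * n + r))"
      by (rule sum.reindex_bij_witness[of _ "\<lambda>r. k * n + r" "\<lambda>m. m - k * n"]) (auto simp: mult.commute)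
    also have "\<dots> = (\<Sum>r<k. \<Sum>j<L. real_of_int (A r i j) / real_of_int D * x ^ r *
        (real_of_int (g j n) * (x ^ k) ^ n))"
    proof (rule sum.cong)
      fix r assume "r \<in> {..<k}"
      then have "real_of_int D * real_of_int (g i (k * n + r)) =
          (\<Sum>j<L. real_of_int (A r i j) * real_of_int (g j n))"
        using arg_cong[OF section_rec[OF i, of r n], of real_of_int] by simp
      then have "real_of_int (g i (k * n + r)) =
          (\<Sum>j<L. real_of_int (A r i j) * real_of_int (g j n)) / real_of_int D"
        using D_pos by (simp add: eq_divide_eq mult.commute)
      also have "\<dots> * x ^ (k * n + r) =
          (\<Sum>j<L. real_of_int (A r i j) / real_of_int D * x ^ r * (real_of_int (g j n) * (x ^ k) ^ n))"
        unfolding power_add power_mult sum_divide_distrib sum_distrib_right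
        by (rule sum.cong) simp_all
      finally show "real_of_int (g i (k * n + r)) * x ^ (k * n + r) =
          (\<Sum>j<L. real_of_int (A r i j) / real_of_int D * x ^ r * (real_of_int (g j n) * (x ^ k) ^ n))" .
    qed simp
    also have "\<dots> = (\<Sum>j<L. poly (T i j) x * (real_of_int (g j n) * (x ^ k) ^ n))"
      by (subst sum.swap) (simp add: poly_T sum_distrib_right)
    finally show ?thesis .
  qed
  have "(\<lambda>n. \<Sum>m\<in>{n*k..<n*k+k}. real_of_int (g i m) * x ^ m) sums G i x"
    using G_sums[OF x i] k_ge_2 by (intro sums_group) auto
  moreover have "(\<lambda>n. \<Sum>j<L. poly (T i j) x * (real_of_int (g j n) * (x ^ k) ^ n)) sums
      (\<Sum>j<L. poly (T i j) x * G j (x ^ k))"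
    using xk by (intro sums_sum sums_mult G_sums) auto
  ultimately show ?thesis unfolding block by (rule sums_unique2)
qed

section \<open>Iterating the system at a point\<close>

text \<open>The row vector u T(x) T(x^k) ... T(x^(k^(n-1))), which carries the linear form u in G(x)
  to one in G(x^(k^n)).\<close>

primrec rho :: "(nat \<Rightarrow> real) \<Rightarrow> real \<Rightarrow> nat \<Rightarrow> nat \<Rightarrow> real" where
  "rho u x 0 = u"
| "rho u x (Suc n) = (\<lambda>j. \<Sum>i<L. rho u x n i * poly (T i j) (x ^ (k ^ n)))"

lemma rho_G:
  assumes "\<bar>x\<bar> < 1"
  shows "(\<Sum>j<L. rho u x n j * G j (x ^ (k ^ n))) = (\<Sum>j<L. u j * G j x)"
proof (induction n)
  case (Suc n)
  let ?y = "x ^ (k ^ n)"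
  have "(\<Sum>i<L. rho u x n i * G i ?y) =
      (\<Sum>i<L. rho u x n i * (\<Sum>j<L. poly (T i j) ?y * G j (?y ^ k)))"
    using abs_power_less_one[OF assms, of n] by (intro sum.cong) (auto simp: G_functional_equation)
  also have "\<dots> = (\<Sum>i<L. \<Sum>j<L. rho u x n i * poly (T i j) ?y * G j (?y ^ k))"
    by (simp add: sum_distrib_left mult.assoc)
  also have "\<dots> = (\<Sum>j<L. rho u x (Suc n) j * G j (?y ^ k))"
    by (subst sum.swap) (simp add: sum_distrib_right)
  also have "?y ^ k = x ^ (k ^ Suc n)" by (simp add: power_mult[symmetric] mult.commute)
  finally show ?case using Suc by simp
qed simp

text \<open>All evaluation points lie in [-1, 1], where the entries of \<open>T\<close> are bounded,
  so each step costs a constant factor.\<close>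

lemma rho_exponential_bound:
  assumes "\<bar>x\<bar> \<le> 1"
  shows "\<exists>C\<ge>1. \<forall>n. \<forall>j<L. \<bar>rho u x n j\<bar> \<le> C ^ (n + 1)"
proof -
  define S where "S = (\<Sum>j<L. \<Sum>i<L. \<Sum>r\<le>degree (T i j). \<bar>coeff (T i j) r\<bar>)"
  define C where "C = 1 + (\<Sum>j<L. \<bar>u j\<bar>) + S"
  have S: "S \<ge> 0" unfolding S_def by (intro sum_nonneg) auto
  have U: "(\<Sum>j<L. \<bar>u j\<bar>) \<ge> 0" by (intro sum_nonneg) auto
  have C: "C \<ge> 1" "S \<le> C" using S U by (auto simp: C_def)
  have "\<forall>j<L. \<bar>rho u x n j\<bar> \<le> C ^ (n + 1)" for n
  proof (induction n)
    case 0
    have "\<bar>u j\<bar> \<le> C" if "j < L" for j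
      using member_le_sum[of j "{..<L}" "\<lambda>j. \<bar>u j\<bar>"] that S by (simp add: C_def)
    then show ?case by simp
  next
    case (Suc n)
    show ?case
    proof (intro allI impI)
      fix j assume j: "j < L"
      let ?y = "x ^ (k ^ n)"
      have y: "\<bar>?y\<bar> \<le> 1" using assms by (simp add: power_abs power_le_one)
      have "\<bar>rho u x (Suc n) j\<bar> \<le> (\<Sum>i<L. \<bar>rho u x n i * poly (T i j) ?y\<bar>)"
        by (simp only: rho.simps) (rule sum_abs)
      also have "\<dots> \<le> (\<Sum>i<L. C ^ (n + 1) * (\<Sum>r\<le>degree (T i j). \<bar>coeff (T i j) r\<bar>))"
        unfolding abs_mult using Suc C y
        by (intro sum_mono mult_mono abs_poly_le_sum_abs_coeff) auto
      also have "\<dots> = C ^ (n + 1) * (\<Sum>i<L. \<Sum>r\<le>degree (T i j). \<bar>coeff (T i j) r\<bar>)"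
        by (simp add: sum_distrib_left)
      also have "\<dots> \<le> C ^ (n + 1) * S"
        unfolding S_def using j C
        by (intro mult_left_mono
            member_le_sum[of j _ "\<lambda>j. \<Sum>i<L. \<Sum>r\<le>degree (T i j). \<bar>coeff (T i j) r\<bar>"])
          (auto intro: sum_nonneg)
      also have "\<dots> \<le> C ^ (n + 1) * C" using C by (intro mult_left_mono) auto
      finally show "\<bar>rho u x (Suc n) j\<bar> \<le> C ^ (Suc n + 1)" by (simp add: mult_ac)
    qed
  qed
  then show ?thesis using C(1) by (intro exI[of _ C]) simp
qed

text \<open>Entries of \<open>T\<close> have degree at most k - 1, so step n costs one factor
  \<open>D\<close> and the power b^(k^n (k-1)). The exponents telescope to k^n because the induction
  starts with one spare factor b = b^(k^0).\<close>

lemma rho_scaled_in_Ints: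
  fixes a b :: int
  assumes b: "b \<noteq> 0" and u: "\<And>j. j < L \<Longrightarrow> real_of_int D * u j \<in> \<int>" and j: "j < L"
  shows "real_of_int D ^ (n + 1) * real_of_int b ^ (k ^ n) *
    rho u (real_of_int a / real_of_int b) n j \<in> \<int>"
  using j
proof (induction n arbitrary: j)
  case 0
  have "real_of_int b * (real_of_int D * u j) \<in> \<int>" by (rule Ints_mult[OF Ints_of_int u[OF 0]])
  then show ?case by (simp add: mult_ac)
next
  case (Suc n)
  let ?x = "real_of_int a / real_of_int b"
  let ?B = "real_of_int b ^ (k ^ n)"
  have T: "real_of_int D * ?B ^ (k - 1) * poly (T i j) (?x ^ (k ^ n)) \<in> \<int>" for i
  proof -
    have "real_of_int (b ^ k ^ n) ^ (k - 1) *
        poly (smult (real_of_int D) (T i j)) (real_of_int (a ^ k ^ n) / real_of_int (b ^ k ^ n)) \<in> \<int>"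
    proof (rule poly_scaled_in_Ints)
      have "coeff (T i j) m = (if m < k then real_of_int (A m i j) / real_of_int D else 0)" for m
        unfolding T_def coeff_sum by simp
      then have "coeff (smult (real_of_int D) (T i j)) m = real_of_int (if m < k then A m i j else 0)" for m
        using D_pos by simp
      then show "coeff (smult (real_of_int D) (T i j)) m \<in> \<int>" for m by (metis Ints_of_int)
      show "degree (smult (real_of_int D) (T i j)) \<le> k - 1"
        unfolding T_def
        by (intro order_trans[OF degree_smult_le] degree_sum_le) (auto intro!: order_trans[OF degree_monom_le])
    qed (use b in simp)
    then show ?thesis by (simp add: power_divide mult_ac)
  qed
  have k: "k ^ Suc n = k ^ n + k ^ n * (k - 1)" using k_ge_2 by (cases k) auto
  have B: "real_of_int b ^ (k ^ Suc n) = ?B * ?B ^ (k - 1)"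
    unfolding k power_add power_mult ..
  have "real_of_int D ^ (Suc n + 1) * real_of_int b ^ (k ^ Suc n) * rho u ?x (Suc n) j =
      (\<Sum>i<L. (real_of_int D ^ (n + 1) * ?B * rho u ?x n i) *
        (real_of_int D * ?B ^ (k - 1) * poly (T i j) (?x ^ (k ^ n))))"
    unfolding B rho.simps sum_distrib_left by (rule sum.cong) simp_all
  also have "\<dots> \<in> \<int>" by (intro Ints_sum Ints_mult[OF Suc.IH T]) simp
  finally show ?case .
qed

section \<open>A linear recurrence between the approximations\<close>

text \<open>The column T(x) T(x^k) ... T(x^(k^(i-1))) P(x^(k^i)). The last i matrix factors of
  \<open>rho\<close> at n + i are moved to the side of P, so that different i can be compared
  against the same row at n.\<close>

primrec pullback :: "(nat \<Rightarrow> real poly) \<Rightarrow> nat \<Rightarrow> nat \<Rightarrow> real poly" where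
  "pullback P 0 = P"
| "pullback P (Suc i) = (\<lambda>j. \<Sum>l<L. T j l * pcompose (pullback P i l) (monom 1 k))"

lemma rho_pullback:
  "(\<Sum>j<L. rho u x n j * poly (pullback P i j) (x ^ (k ^ n))) =
   (\<Sum>j<L. rho u x (n + i) j * poly (P j) (x ^ (k ^ (n + i))))"
proof (induction i arbitrary: n)
  case (Suc i)
  let ?y = "x ^ (k ^ n)"
  have y: "?y ^ k = x ^ (k ^ Suc n)" by (simp add: power_mult[symmetric] mult.commute)
  have "(\<Sum>j<L. rho u x n j * poly (pullback P (Suc i) j) ?y) =
      (\<Sum>j<L. \<Sum>l<L. rho u x n j * poly (T j l) ?y * poly (pullback P i l) (x ^ (k ^ Suc n)))"
    unfolding y[symmetric]
    by (simp add: poly_sum poly_pcompose poly_monom sum_distrib_left mult.assoc)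
  also have "\<dots> = (\<Sum>l<L. rho u x (Suc n) l * poly (pullback P i l) (x ^ (k ^ Suc n)))"
    by (subst sum.swap) (simp add: sum_distrib_right)
  also have "\<dots> = (\<Sum>j<L. rho u x (Suc n + i) j * poly (P j) (x ^ (k ^ (Suc n + i))))"
    by (rule Suc.IH)
  finally show ?case by simp
qed simp

text \<open>The dependence is an identity between polynomials, found without reference to n.
  Evaluating it at x^(k^n) and pairing it with the row at n gives one recurrence valid for every
  n.\<close>

lemma approximations_linear_recurrence:
  obtains c t where "t \<le> L + 1" "c t \<noteq> 0"
    "\<And>n. (\<Sum>i\<le>t. poly (c i) (x ^ (k ^ n)) * poly Q (x ^ (k ^ (n + i)))) = 0"
    "\<And>n. (\<Sum>i\<le>t. poly (c i) (x ^ (k ^ n)) *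
       (\<Sum>j<L. rho u x (n + i) j * poly (P j) (x ^ (k ^ (n + i))))) = 0"
proof -
  \<comment> \<open>Component L holds the denominator Q, the components below L the pulled back
    numerators.\<close>
  define V where "V = (\<lambda>i j. if j = L then pcompose Q (monom 1 (k ^ i)) else pullback P i j)"
  have "\<exists>c. (\<exists>i\<in>{..L+1}. c i \<noteq> 0) \<and> (\<forall>j<L + 1. (\<Sum>i\<in>{..L+1}. c i * V i j) = 0)"
    by (rule homogeneous_system_nontrivial_solution) auto
  then obtain c where c: "\<exists>i\<in>{..L+1}. c i \<noteq> 0" "\<And>j. j < L + 1 \<Longrightarrow> (\<Sum>i\<le>L+1. c i * V i j) = 0"
    by blast
  \<comment> \<open>Cutting at the last nonzero coefficient lets the recurrence be solved for its
    newest term wherever \<open>c t\<close> does not vanish.\<close>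
  define t where "t = Max {i. i \<le> L + 1 \<and> c i \<noteq> 0}"
  have "t \<in> {i. i \<le> L + 1 \<and> c i \<noteq> 0}" unfolding t_def using c(1) by (intro Max_in) auto
  then have t: "t \<le> L + 1" "c t \<noteq> 0" by auto
  have t': "i \<le> t" if "i \<le> L + 1" "c i \<noteq> 0" for i
    unfolding t_def using that by (intro Max_ge) auto
  have sum: "(\<Sum>i\<le>t. c i * V i j) = 0" if "j < L + 1" for j
  proof -
    have "(\<Sum>i\<le>t. c i * V i j) = (\<Sum>i\<le>L+1. c i * V i j)"
      using t t' by (intro sum.mono_neutral_left) force+
    with c(2)[OF that] show ?thesis by simp
  qed
  have eval: "(\<Sum>i\<le>t. poly (c i) y * poly (V i j) y) = 0" if "j < L + 1" for j y
    using arg_cong[OF sum[OF that], of "\<lambda>p. poly p y"] by (simp add: poly_sum)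
  have "(\<Sum>i\<le>t. poly (c i) (x ^ (k ^ n)) * poly Q (x ^ (k ^ (n + i)))) = 0" for n
    using eval[of L "x ^ (k ^ n)"]
    by (simp add: V_def poly_pcompose poly_monom power_add power_mult)
  moreover have "(\<Sum>i\<le>t. poly (c i) (x ^ (k ^ n)) *
      (\<Sum>j<L. rho u x (n + i) j * poly (P j) (x ^ (k ^ (n + i))))) = 0" for n
  proof -
    let ?y = "x ^ (k ^ n)"
    have "(\<Sum>i\<le>t. poly (c i) ?y * (\<Sum>j<L. rho u x (n + i) j * poly (P j) (x ^ (k ^ (n + i))))) =
        (\<Sum>i\<le>t. \<Sum>j<L. rho u x n j * (poly (c i) ?y * poly (V i j) ?y))"
      unfolding rho_pullback[symmetric] by (simp add: V_def sum_distrib_left mult_ac)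
    also have "\<dots> = (\<Sum>j<L. rho u x n j * (\<Sum>i\<le>t. poly (c i) ?y * poly (V i j) ?y))"
      by (subst sum.swap) (simp add: sum_distrib_left)
    also have "\<dots> = 0" using eval by simp
    finally show ?thesis .
  qed
  ultimately show ?thesis using t by (intro that[of t c])
qed

section \<open>Simultaneous Pade approximation\<close>

text \<open>Q has M + 1 unknown coefficients. Killing the coefficients of each Q G_j in degrees M +
  1 to N - 1 imposes L (N - 1 - M) <= M homogeneous integer equations, so a nonzero integral Q
  exists; P_j is the part of Q G_j up to degree M.\<close>

lemma pade_approximants:
  fixes r :: real
  assumes MN: "M < N" "L * (N - 1 - M) \<le> M" and r: "0 < r" "r < 1"
  obtains Q P K where "Q \<noteq> 0" "\<And>i. coeff Q i \<in> \<int>" "degree Q \<le> M"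
    "\<And>j i. coeff (P j) i \<in> \<int>" "\<And>j. degree (P j) \<le> M" "K \<ge> 0"
    "\<And>j x. j < L \<Longrightarrow> \<bar>x\<bar> \<le> r \<Longrightarrow> \<bar>poly Q x * G j x - poly (P j) x\<bar> \<le> K * \<bar>x\<bar> ^ N"
proof -
  define w where "w = N - 1 - M"
  \<comment> \<open>One index e encodes the pair (j, degree): j is \<open>e div w\<close>, and the
    degree is M + 1 + \<open>e mod w\<close>.\<close>
  have "\<exists>c. (\<exists>i\<in>{..M}. c i \<noteq> 0) \<and>
      (\<forall>e<L * w. (\<Sum>i\<in>{..M}. c i * g (e div w) (M + 1 + e mod w - i)) = 0)"
    by (rule homogeneous_system_nontrivial_solution) (use MN in \<open>auto simp: w_def\<close>)
  then obtain c0 where c0: "\<exists>i\<le>M. c0 i \<noteq> 0"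
    "\<And>e. e < L * w \<Longrightarrow> (\<Sum>i\<le>M. c0 i * g (e div w) (M + 1 + e mod w - i)) = 0" by auto
  define c where "c = (\<lambda>i. if i \<le> M then c0 i else 0)"
  \<comment> \<open>Extending the coefficients by 0 beyond M makes \<open>h j\<close> the plain
    Cauchy product, that is, the coefficient sequence of Q G_j.\<close>
  define h where "h = (\<lambda>j n. \<Sum>i\<le>n. c i * g j (n - i))"
  have h0: "h j d = 0" if "j < L" "M < d" "d < N" for j d
  proof -
    define e where "e = j * w + (d - M - 1)"
    have w: "d - M - 1 < w" using that by (simp add: w_def)
    then have "e < Suc j * w" by (simp add: e_def)
    also have "\<dots> \<le> L * w" using that by (intro mult_right_mono) auto
    finally have "e < L * w" .
    moreover have "e div w = j" "e mod w = d - M - 1" using w by (auto simp: e_def)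
    ultimately have "(\<Sum>i\<le>M. c0 i * g j (M + 1 + (d - M - 1) - i)) = 0" using c0(2)[of e] by simp
    then have "(\<Sum>i\<le>M. c0 i * g j (d - i)) = 0" using that by simp
    moreover have "h j d = (\<Sum>i\<le>M. c0 i * g j (d - i))"
      unfolding h_def using that by (intro sum.mono_neutral_cong_right) (auto simp: c_def)
    ultimately show ?thesis by simp
  qed
  define Q where "Q = (\<Sum>i\<le>M. monom (real_of_int (c i)) i)"
  define P where "P = (\<lambda>j. \<Sum>d\<le>M. monom (real_of_int (h j d)) d)"
  have cQ: "coeff Q i = real_of_int (c i)" for i by (simp add: Q_def coeff_sum c_def)
  have Q0: "Q \<noteq> 0"
  proof
    assume "Q = 0"
    then have "c i = 0" for i using cQ[of i] by simp
    then show False using c0(1) by (metis c_def)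
  qed
  have cP: "coeff (P j) i = real_of_int (if i \<le> M then h j i else 0)" for i j
    by (simp add: P_def coeff_sum)
  have dQ: "degree Q \<le> M" by (rule degree_le) (simp add: cQ c_def)
  have dP: "degree (P j) \<le> M" for j by (rule degree_le) (simp add: cP)
  have Q_sums: "(\<lambda>i. real_of_int (c i) * x ^ i) sums poly Q x" for x
  proof -
    have "poly Q x = (\<Sum>i\<le>M. real_of_int (c i) * x ^ i)" by (simp add: Q_def poly_sum poly_monom)
    then show ?thesis using sums_finite[of "{..M}" "\<lambda>i. real_of_int (c i) * x ^ i"]
      by (simp add: c_def)
  qed
  have Q_abs: "summable (\<lambda>i. \<bar>real_of_int (c i) * x ^ i\<bar>)" for x
    by (rule summable_finite[of "{..M}"]) (auto simp: c_def)
  have h_sums: "(\<lambda>n. real_of_int (h j n) * x ^ n) sums (poly Q x * G j x)"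
    if "j < L" "\<bar>x\<bar> < 1" for j x
  proof -
    have "(\<lambda>n. \<Sum>i\<le>n. (real_of_int (c i) * x ^ i) * (real_of_int (g j (n - i)) * x ^ (n - i))) sums
        ((\<Sum>i. real_of_int (c i) * x ^ i) * (\<Sum>i. real_of_int (g j i) * x ^ i))"
      using Q_abs summable_abs_G[OF that(2,1)] by (intro Cauchy_product_sums) (auto simp only: real_norm_def)
    moreover have "(\<Sum>i\<le>n. (real_of_int (c i) * x ^ i) * (real_of_int (g j (n - i)) * x ^ (n - i))) =
        real_of_int (h j n) * x ^ n" for n
      unfolding h_def of_int_sum sum_distrib_right
    proof (rule sum.cong)
      fix i assume "i \<in> {..n}"
      then have "x ^ n = x ^ i * x ^ (n - i)" by (simp flip: power_add)
      then show "(real_of_int (c i) * x ^ i) * (real_of_int (g j (n - i)) * x ^ (n - i)) =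
          real_of_int (c i * g j (n - i)) * x ^ n" by simp
    qed simp
    moreover have "(\<Sum>i. real_of_int (c i) * x ^ i) = poly Q x"
      using Q_sums by (rule sums_unique[symmetric])
    ultimately show ?thesis by (simp add: G_def)
  qed
  have h_abs: "summable (\<lambda>n. \<bar>real_of_int (h j n)\<bar> * r ^ n)" if "j < L" for j
  proof -
    have "summable (\<lambda>n. \<Sum>i\<le>n. \<bar>real_of_int (c i) * r ^ i\<bar> * \<bar>real_of_int (g j (n - i)) * r ^ (n - i)\<bar>)"
      using Q_abs summable_abs_G[of r j] that r
      by (intro summable_Cauchy_product) (auto simp only: real_norm_def abs_abs abs_of_pos)
    then show ?thesis
    proof (rule summable_comparison_test[rotated], intro exI[of _ 0] allI impI)
      fix n
      have "norm (\<bar>real_of_int (h j n)\<bar> * r ^ n) = \<bar>\<Sum>i\<le>n. real_of_int (c i * g j (n - i)) * r ^ n\<bar>"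
        using r by (simp add: h_def abs_mult flip: sum_distrib_right)
      also have "\<dots> \<le> (\<Sum>i\<le>n. \<bar>real_of_int (c i * g j (n - i)) * r ^ n\<bar>)" by (rule sum_abs)
      also have "\<dots> = (\<Sum>i\<le>n. \<bar>real_of_int (c i) * r ^ i\<bar> * \<bar>real_of_int (g j (n - i)) * r ^ (n - i)\<bar>)"
      proof (rule sum.cong)
        fix i assume "i \<in> {..n}"
        then have "r ^ n = r ^ i * r ^ (n - i)" by (simp flip: power_add)
        then show "\<bar>real_of_int (c i * g j (n - i)) * r ^ n\<bar> =
            \<bar>real_of_int (c i) * r ^ i\<bar> * \<bar>real_of_int (g j (n - i)) * r ^ (n - i)\<bar>"
          by (simp add: abs_mult)
      qed simp
      finally show "norm (\<bar>real_of_int (h j n)\<bar> * r ^ n) \<le>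
        (\<Sum>i\<le>n. \<bar>real_of_int (c i) * r ^ i\<bar> * \<bar>real_of_int (g j (n - i)) * r ^ (n - i)\<bar>)" .
    qed
  qed
  have tail: "summable (\<lambda>n. \<bar>real_of_int (h j (n + N))\<bar> * r ^ n)" if "j < L" for j
  proof -
    have "summable (\<lambda>n. \<bar>real_of_int (h j (n + N))\<bar> * r ^ (n + N))"
      using h_abs[OF that] by (rule summable_ignore_initial_segment)
    then have "summable (\<lambda>n. \<bar>real_of_int (h j (n + N))\<bar> * r ^ (n + N) / r ^ N)"
      by (rule summable_divide)
    then show ?thesis using r by (simp add: power_add)
  qed
  \<comment> \<open>After removing x^N the remainder series is majorised by its absolute values at
    r, which gives a constant uniform in |x| <= r.\<close>
  define K where "K = (\<lambda>j. \<Sum>n. \<bar>real_of_int (h j (n + N))\<bar> * r ^ n)"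
  have K0: "K j \<ge> 0" if "j < L" for j
    unfolding K_def using tail[OF that] r by (intro suminf_nonneg) auto
  have bound: "\<bar>poly Q x * G j x - poly (P j) x\<bar> \<le> K j * \<bar>x\<bar> ^ N" if j: "j < L" and x: "\<bar>x\<bar> \<le> r" for j x
  proof -
    have "poly (P j) x = (\<Sum>d\<le>M. real_of_int (h j d) * x ^ d)"
      by (simp add: P_def poly_sum poly_monom)
    also have "\<dots> = (\<Sum>d<N. real_of_int (h j d) * x ^ d)"
      using MN h0[OF j] by (intro sum.mono_neutral_left) auto
    finally have "(\<lambda>n. real_of_int (h j (n + N)) * x ^ (n + N)) sums (poly Q x * G j x - poly (P j) x)"
      using h_sums[OF j, of x] x r by (subst sums_iff_shift) auto
    then have eq: "poly Q x * G j x - poly (P j) x = (\<Sum>n. real_of_int (h j (n + N)) * x ^ (n + N))"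
      by (rule sums_unique)
    have le: "\<bar>real_of_int (h j (n + N)) * x ^ (n + N)\<bar> \<le> \<bar>real_of_int (h j (n + N))\<bar> * r ^ n * \<bar>x\<bar> ^ N" for n
      unfolding power_add abs_mult power_abs mult.assoc
      using x by (intro mult_left_mono mult_right_mono power_mono) auto
    have "norm (\<Sum>n. real_of_int (h j (n + N)) * x ^ (n + N)) \<le>
        (\<Sum>n. \<bar>real_of_int (h j (n + N))\<bar> * r ^ n * \<bar>x\<bar> ^ N)"
      using le tail[OF j] by (intro norm_suminf_le summable_mult2) auto
    also have "\<dots> = K j * \<bar>x\<bar> ^ N" unfolding K_def using tail[OF j] by (intro suminf_mult2[symmetric])
    finally show ?thesis by (simp add: eq)
  qed
  have "\<bar>poly Q x * G j x - poly (P j) x\<bar> \<le> (\<Sum>j<L. K j) * \<bar>x\<bar> ^ N" if "j < L" "\<bar>x\<bar> \<le> r" for j x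
  proof -
    have "K j \<le> (\<Sum>j<L. K j)" using that K0 by (intro member_le_sum) auto
    then have "K j * \<bar>x\<bar> ^ N \<le> (\<Sum>j<L. K j) * \<bar>x\<bar> ^ N" by (rule mult_right_mono) simp
    with bound[OF that] show ?thesis by linarith
  qed
  moreover have "(\<Sum>j<L. K j) \<ge> 0" using K0 by (intro sum_nonneg) auto
  ultimately show ?thesis using Q0 dQ dP by (intro that[of Q P "\<Sum>j<L. K j"]) (auto simp: cQ cP)
qed

section \<open>The exponent of a value of a Mahler system\<close>

text \<open>Applies the approximation criterion with H = M + 2 and window length l = L to the Pade
  forms at x^(k^n), multiplied by a common denominator.\<close>

lemma irrationality_exponent_value_le:
  fixes a b :: int and u :: "nat \<Rightarrow> real"
  assumes b: "b \<ge> 2" and a: "a \<noteq> 0" and MN: "M < N" "L * (N - 1 - M) \<le> M"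
    and small: "\<bar>a\<bar> ^ N * b ^ (M + 2) < b ^ N"
    and u: "\<And>j. j < L \<Longrightarrow> real_of_int D * u j \<in> \<int>"
  shows "irrationality_exponent (\<Sum>j<L. u j * G j (real_of_int a / real_of_int b))
    \<le> ereal (1 + real ((M + 2) * k ^ (L + 1)))"
proof -
  define x where "x = real_of_int a / real_of_int b"
  define \<beta> where "\<beta> = real_of_int b"
  define \<delta> where "\<delta> = real_of_int D"
  have \<beta>: "\<beta> \<ge> 2" and \<delta>: "\<delta> \<ge> 1" using b D_pos by (auto simp: \<beta>_def \<delta>_def)
  define \<xi> where "\<xi> = (\<Sum>j<L. u j * G j x)"
  have "\<bar>a\<bar> < b"
  proof (rule ccontr)
    assume "\<not> \<bar>a\<bar> < b"
    then have "b ^ N \<le> \<bar>a\<bar> ^ N" using b by (intro power_mono) auto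
    also have "\<dots> \<le> \<bar>a\<bar> ^ N * b ^ (M + 2)"
      using b mult_left_mono[OF one_le_power[of b "M + 2"], of "\<bar>a\<bar> ^ N"] by simp
    finally show False using small by simp
  qed
  then have x: "0 < \<bar>x\<bar>" "\<bar>x\<bar> < 1" using a b by (auto simp: x_def)
  \<comment> \<open>M + 1 of the factors b come from the denominators \<open>X n\<close>, one from
    the margin b^(k^n) demanded by the criterion. The hypothesis \<open>small\<close> says precisely
    that this ratio is below 1.\<close>
  define \<theta> where "\<theta> = \<beta> ^ (M + 2) * \<bar>x\<bar> ^ N"
  have "real_of_int (\<bar>a\<bar> ^ N * b ^ (M + 2)) < real_of_int (b ^ N)" using small by (subst of_int_less_iff)
  then have \<theta>: "0 \<le> \<theta>" "\<theta> < 1"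
    using b by (auto simp: \<theta>_def \<beta>_def x_def power_divide divide_less_eq mult.commute)
  define y where "y = (\<lambda>n. x ^ (k ^ n))"
  have y: "\<bar>y n\<bar> \<le> \<bar>x\<bar>" for n
    unfolding y_def power_abs using x k_ge_2 power_decreasing[of 1 "k ^ n" "\<bar>x\<bar>"] by simp
  obtain Q P K where Q0: "Q \<noteq> 0" and cQ: "\<And>i. coeff Q i \<in> \<int>" and dQ: "degree Q \<le> M"
    and cP: "\<And>j i. coeff (P j) i \<in> \<int>" and dP: "\<And>j. degree (P j) \<le> M" and K: "K \<ge> 0"
    and pade: "\<And>j z. j < L \<Longrightarrow> \<bar>z\<bar> \<le> \<bar>x\<bar> \<Longrightarrow> \<bar>poly Q z * G j z - poly (P j) z\<bar> \<le> K * \<bar>z\<bar> ^ N"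
    by (rule pade_approximants[OF MN x]) (rule that)
  obtain C where C: "C \<ge> 1" "\<And>n j. j < L \<Longrightarrow> \<bar>rho u x n j\<bar> \<le> C ^ (n + 1)"
    using rho_exponential_bound[of x u] x by auto
  define q where "q = (\<lambda>n. poly Q (y n))"
  define p where "p = (\<lambda>n. \<Sum>j<L. rho u x n j * poly (P j) (y n))"
  \<comment> \<open>The powers of D and one b^(k^n) clear \<open>rho\<close>; the remaining M
    factors b^(k^n) clear polynomials of degree at most M.\<close>
  define X where "X = (\<lambda>n. \<delta> ^ (n + 1) * \<beta> ^ (k ^ n) * (\<beta> ^ (k ^ n)) ^ M)"
  have X0: "X n > 0" for n using \<beta> \<delta> by (simp add: X_def)
  have polyZ: "(\<beta> ^ (k ^ n)) ^ M * poly R (y n) \<in> \<int>" if "\<And>i. coeff R i \<in> \<int>" "degree R \<le> M" for n R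
    using poly_scaled_in_Ints[of R M "b ^ (k ^ n)" "a ^ (k ^ n)"] that b
    by (simp add: \<beta>_def y_def x_def power_divide)
  have qZ: "X n * q n \<in> \<int>" for n
  proof -
    have "X n * q n = real_of_int (D ^ (n + 1) * b ^ (k ^ n)) * ((\<beta> ^ (k ^ n)) ^ M * poly Q (y n))"
      by (simp add: X_def q_def \<beta>_def \<delta>_def)
    also have "\<dots> \<in> \<int>" by (rule Ints_mult[OF Ints_of_int polyZ[OF cQ dQ]])
    finally show ?thesis .
  qed
  have pZ: "X n * p n \<in> \<int>" for n
  proof -
    have "X n * p n = (\<Sum>j<L. (\<delta> ^ (n + 1) * \<beta> ^ (k ^ n) * rho u x n j) *
        ((\<beta> ^ (k ^ n)) ^ M * poly (P j) (y n)))"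
      unfolding X_def p_def sum_distrib_left by (rule sum.cong) simp_all
    also have "\<dots> \<in> \<int>"
    proof (rule Ints_sum)
      fix j assume "j \<in> {..<L}"
      then have "\<delta> ^ (n + 1) * \<beta> ^ (k ^ n) * rho u x n j \<in> \<int>"
        unfolding \<delta>_def \<beta>_def x_def using b by (intro rho_scaled_in_Ints u) auto
      then show "(\<delta> ^ (n + 1) * \<beta> ^ (k ^ n) * rho u x n j) * ((\<beta> ^ (k ^ n)) ^ M * poly (P j) (y n)) \<in> \<int>"
        by (rule Ints_mult[OF _ polyZ[OF cP dP]])
    qed
    finally show ?thesis .
  qed
  \<comment> \<open>The floors only change the type: \<open>X n * q n\<close> and
    \<open>X n * p n\<close> are already integers.\<close>
  define qh where "qh = (\<lambda>n. \<lfloor>X n * q n\<rfloor>)"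
  define ph where "ph = (\<lambda>n. \<lfloor>X n * p n\<rfloor>)"
  have qh: "real_of_int (qh n) = X n * q n" for n
    unfolding qh_def using qZ[of n] by (auto elim!: Ints_cases)
  have ph: "real_of_int (ph n) = X n * p n" for n
    unfolding ph_def using pZ[of n] by (auto elim!: Ints_cases)

  have err: "\<bar>real_of_int (qh n) * \<xi> - real_of_int (ph n)\<bar> * \<beta> ^ (k ^ n) \<le>
      (real L * K * \<delta> * C) * (\<delta> * C) ^ n * \<theta> ^ (k ^ n)" for n
  proof -
    \<comment> \<open>By \<open>rho_G\<close> the value \<xi> is also the pairing of the row at n
      with G(y_n), so the error is that row applied to the Pade remainders.\<close>
    have "q n * \<xi> - p n = (\<Sum>j<L. rho u x n j * (poly Q (y n) * G j (y n) - poly (P j) (y n)))"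
      unfolding \<xi>_def rho_G[OF x(2), of u n, symmetric] p_def q_def y_def
      by (simp add: sum_distrib_left sum_subtractf algebra_simps)
    then have "\<bar>q n * \<xi> - p n\<bar> \<le> (\<Sum>j<L. \<bar>rho u x n j\<bar> * \<bar>poly Q (y n) * G j (y n) - poly (P j) (y n)\<bar>)"
      by (simp only: abs_mult[symmetric] sum_abs)
    also have "\<dots> \<le> (\<Sum>j<L. C ^ (n + 1) * (K * \<bar>y n\<bar> ^ N))"
      using C pade y by (intro sum_mono mult_mono) auto
    finally have e: "\<bar>q n * \<xi> - p n\<bar> \<le> real L * (C ^ (n + 1) * (K * \<bar>y n\<bar> ^ N))" by simp
    have yN: "\<bar>y n\<bar> ^ N = (\<bar>x\<bar> ^ N) ^ (k ^ n)"
      by (simp add: y_def power_abs mult.commute flip: power_mult)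
    have "\<bar>real_of_int (qh n) * \<xi> - real_of_int (ph n)\<bar> = X n * \<bar>q n * \<xi> - p n\<bar>"
      using X0[of n] by (simp add: qh ph abs_mult mult.assoc flip: right_diff_distrib)
    also have "\<dots> \<le> X n * (real L * (C ^ (n + 1) * (K * \<bar>y n\<bar> ^ N)))"
      using e X0[of n] by (intro mult_left_mono) auto
    finally have "\<bar>real_of_int (qh n) * \<xi> - real_of_int (ph n)\<bar> * \<beta> ^ (k ^ n) \<le>
        X n * (real L * (C ^ (n + 1) * (K * \<bar>y n\<bar> ^ N))) * \<beta> ^ (k ^ n)"
      using \<beta> by (intro mult_right_mono) auto
    also have "\<dots> = (real L * K * \<delta> * C) * (\<delta> * C) ^ n *
        (\<beta> ^ (k ^ n) * \<beta> ^ (k ^ n) * (\<beta> ^ (k ^ n)) ^ M * (\<bar>x\<bar> ^ N) ^ (k ^ n))"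
      unfolding yN by (simp add: X_def power_mult_distrib)
    also have "\<beta> ^ (k ^ n) * \<beta> ^ (k ^ n) * (\<beta> ^ (k ^ n)) ^ M = (\<beta> ^ (M + 2)) ^ (k ^ n)"
      by (simp add: power_add power_mult_distrib power2_eq_square mult.commute flip: power_mult)
    also have "(\<beta> ^ (M + 2)) ^ (k ^ n) * (\<bar>x\<bar> ^ N) ^ (k ^ n) = \<theta> ^ (k ^ n)"
      by (simp add: \<theta>_def power_mult_distrib)
    finally show ?thesis .
  qed
  have \<delta>C: "\<delta> * C \<ge> 1" using \<delta> C mult_mono[of 1 \<delta> 1 C] by simp
  have "eventually (\<lambda>n. (real L * K * \<delta> * C) * (\<delta> * C) ^ n * \<theta> ^ (k ^ n) \<le> 1) sequentially"
    using k_ge_2 \<theta> \<delta>C K \<delta> C by (intro eventually_power_times_double_power_le) auto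
  then have ev1: "eventually (\<lambda>n. \<bar>real_of_int (qh n) * \<xi> - real_of_int (ph n)\<bar> * \<beta> ^ (k ^ n) \<le> 1) sequentially"
    by eventually_elim (rule order_trans[OF err])

  define S where "S = (\<Sum>i\<le>degree Q. \<bar>coeff Q i\<bar>)"
  have S: "S \<ge> 0" unfolding S_def by (intro sum_nonneg) auto
  \<comment> \<open>One more factor b^(k^n) absorbs the coefficient sum of Q and the powers of D,
    which raises the exponent from M + 1 to M + 2.\<close>
  have "eventually (\<lambda>n. (S * \<delta>) * \<delta> ^ n * (1 / \<beta>) ^ (k ^ n) \<le> 1) sequentially"
    using k_ge_2 \<beta> \<delta> S by (intro eventually_power_times_double_power_le) auto
  then have ev2: "eventually (\<lambda>n. \<bar>real_of_int (qh n)\<bar> \<le> \<beta> ^ ((M + 2) * k ^ n)) sequentially"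
  proof eventually_elim
    case (elim n)
    then have le: "S * \<delta> ^ (n + 1) \<le> \<beta> ^ (k ^ n)"
      using \<beta> by (simp add: power_divide divide_le_eq mult.assoc)
    have "\<bar>real_of_int (qh n)\<bar> = X n * \<bar>poly Q (y n)\<bar>"
      using X0[of n] by (simp add: qh q_def abs_mult)
    also have "\<dots> \<le> X n * S"
      unfolding S_def using X0[of n] y[of n] x by (intro mult_left_mono abs_poly_le_sum_abs_coeff) auto
    also have "\<dots> = (S * \<delta> ^ (n + 1)) * (\<beta> ^ (k ^ n) * (\<beta> ^ (k ^ n)) ^ M)" by (simp add: X_def)
    also have "\<dots> \<le> \<beta> ^ (k ^ n) * (\<beta> ^ (k ^ n) * (\<beta> ^ (k ^ n)) ^ M)"
      using le \<beta> by (intro mult_right_mono) auto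
    also have "\<dots> = (\<beta> ^ (k ^ n)) ^ (M + 2)" by simp
    also have "\<dots> = \<beta> ^ ((M + 2) * k ^ n)" by (metis mult.commute power_mult)
    finally show ?case .
  qed

  obtain c t where t: "t \<le> L + 1" and ct: "c t \<noteq> 0"
    and recq: "\<And>n. (\<Sum>i\<le>t. poly (c i) (y n) * q (n + i)) = 0"
    and recp: "\<And>n. (\<Sum>i\<le>t. poly (c i) (y n) * p (n + i)) = 0"
    unfolding p_def q_def y_def
    by (rule approximations_linear_recurrence[where x = x and Q = Q and u = u and P = P])
      (rule that[unfolded p_def q_def y_def])
  have ev3: "eventually (\<lambda>n. poly (c t) (y n) \<noteq> 0) sequentially"
    unfolding y_def using ct x k_ge_2 by (rule eventually_poly_iterated_power_nonzero)
  have ev4: "eventually (\<lambda>n. q n \<noteq> 0) sequentially"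
    unfolding q_def y_def using Q0 x k_ge_2 by (rule eventually_poly_iterated_power_nonzero)
  obtain n0 where n0: "\<And>n. n \<ge> n0 \<Longrightarrow> \<bar>real_of_int (qh n) * \<xi> - real_of_int (ph n)\<bar> * \<beta> ^ (k ^ n) \<le> 1"
    "\<And>n. n \<ge> n0 \<Longrightarrow> \<bar>real_of_int (qh n)\<bar> \<le> \<beta> ^ ((M + 2) * k ^ n)"
    "\<And>n. n \<ge> n0 \<Longrightarrow> poly (c t) (y n) \<noteq> 0" "\<And>n. n \<ge> n0 \<Longrightarrow> q n \<noteq> 0"
    using eventually_conj[OF ev1 eventually_conj[OF ev2 eventually_conj[OF ev3 ev4]]]
    unfolding eventually_sequentially by blast
  have "irrationality_exponent \<xi> \<le> ereal (1 + real ((M + 2) * k ^ (L + 1)))"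
  proof (rule irrationality_exponent_le_of_approximations[where b = \<beta>, OF _ k_ge_2 n0(1,2)])
    show "1 < \<beta>" using \<beta> by simp
    fix n :: nat and s :: int and d :: nat
    assume n: "n0 \<le> n" and d: "0 < d" and ne: "\<xi> \<noteq> real_of_int s / real d"
    show "\<exists>j\<in>{n..n + L}. s * qh j \<noteq> int d * ph j"
    proof (rule ccontr)
      assume "\<not> ?thesis"
      then have window: "s * qh j = int d * ph j" if "n \<le> j" "j \<le> n + L" for j using that by auto
      \<comment> \<open>\<open>z\<close> vanishes exactly where the approximation agrees with s/d,
        and it inherits the common recurrence of \<open>q\<close> and \<open>p\<close>.\<close>
      define z where "z = (\<lambda>j. real_of_int s * q j - real d * p j)"
      have z_iff: "z j = 0 \<longleftrightarrow> s * qh j = int d * ph j" for j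
      proof -
        have "s * qh j = int d * ph j \<longleftrightarrow> real_of_int (s * qh j) = real_of_int (int d * ph j)"
          by (simp only: of_int_eq_iff)
        also have "\<dots> \<longleftrightarrow> X j * z j = 0" by (simp add: qh ph z_def algebra_simps)
        finally show ?thesis using X0[of j] by simp
      qed
      have recz: "(\<Sum>i\<le>t. poly (c i) (y m) * z (m + i)) = 0" for m
      proof -
        have "(\<Sum>i\<le>t. poly (c i) (y m) * z (m + i)) =
            real_of_int s * (\<Sum>i\<le>t. poly (c i) (y m) * q (m + i)) -
            real d * (\<Sum>i\<le>t. poly (c i) (y m) * p (m + i))"
          unfolding sum_distrib_left sum_subtractf[symmetric]
          by (rule sum.cong) (simp_all add: z_def algebra_simps)
        then show ?thesis by (simp add: recq recp)
      qed
      \<comment> \<open>The window has L + 1 >= t consecutive zeros, and the leading coefficient is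
        nonzero beyond \<open>n0\<close>, so zeros propagate forever.\<close>
      have z0: "z j = 0" if "j \<ge> n" for j
        using that
      proof (induction j rule: less_induct)
        case (less j)
        show ?case
        proof (cases "j \<le> n + L")
          case True
          with less.prems window show ?thesis by (simp add: z_iff)
        next
          case False
          define m where "m = j - t"
          have m: "j = m + t" "n \<le> m" using False t by (auto simp: m_def)
          have "(\<Sum>i\<le>t. poly (c i) (y m) * z (m + i)) =
              (\<Sum>i<t. poly (c i) (y m) * z (m + i)) + poly (c t) (y m) * z (m + t)"
            by (simp add: lessThan_Suc_atMost[symmetric])
          also have "(\<Sum>i<t. poly (c i) (y m) * z (m + i)) = 0"
            using less.IH m by (intro sum.neutral) auto
          finally have "poly (c t) (y m) * z j = 0" using recz[of m] m by simp
          with n0(3)[of m] n m show ?thesis by simp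
        qed
      qed
      \<comment> \<open>If all later approximations equal s/d, then the error is |qh_j| times this
        fixed positive distance. As |qh_j| >= 1, it cannot decay like b^(-k^j).\<close>
      define \<epsilon> where "\<epsilon> = \<bar>\<xi> - real_of_int s / real d\<bar>"
      have \<epsilon>: "\<epsilon> > 0" using ne by (simp add: \<epsilon>_def)
      have "\<epsilon> * \<beta> ^ (k ^ j) \<le> 1" if "j \<ge> n" for j
      proof -
        have "p j = q j * (real_of_int s / real d)"
          using z0[OF that] d by (simp add: z_def field_simps)
        then have "real_of_int (qh j) * \<xi> - real_of_int (ph j) =
            real_of_int (qh j) * (\<xi> - real_of_int s / real d)"
          by (simp add: qh ph algebra_simps)
        then have "\<bar>real_of_int (qh j) * \<xi> - real_of_int (ph j)\<bar> = \<bar>real_of_int (qh j)\<bar> * \<epsilon>"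
          by (simp add: \<epsilon>_def abs_mult)
        then have le: "\<bar>real_of_int (qh j)\<bar> * \<epsilon> * \<beta> ^ (k ^ j) \<le> 1" using n0(1)[of j] n that by simp
        have "real_of_int (qh j) \<noteq> 0" using n0(4)[of j] n that X0[of j] by (simp add: qh)
        then have "qh j \<noteq> 0" by simp
        then have "1 \<le> \<bar>real_of_int (qh j)\<bar>" by linarith
        then have "1 * (\<epsilon> * \<beta> ^ (k ^ j)) \<le> \<bar>real_of_int (qh j)\<bar> * (\<epsilon> * \<beta> ^ (k ^ j))"
          using \<epsilon> \<beta> by (intro mult_right_mono) auto
        with le show ?thesis by simp
      qed
      moreover obtain e where e: "1 / \<epsilon> < \<beta> ^ e" using real_arch_pow[of \<beta> "1 / \<epsilon>"] \<beta> by auto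
      moreover have "\<beta> ^ e \<le> \<beta> ^ (k ^ (n + e))"
      proof (rule power_increasing)
        have "e < k ^ e" using k_ge_2 less_exp[of e] power_mono[of 2 k e] by linarith
        also have "k ^ e \<le> k ^ (n + e)" using k_ge_2 by (intro power_increasing) auto
        finally show "e \<le> k ^ (n + e)" by simp
      qed (use \<beta> in simp)
      ultimately have "1 / \<epsilon> < \<beta> ^ (k ^ (n + e))" "\<epsilon> * \<beta> ^ (k ^ (n + e)) \<le> 1" by auto
      then show False using \<epsilon> by (simp add: divide_less_eq mult.commute)
    qed
  qed
  then show ?thesis by (simp add: \<xi>_def x_def)
qed

end

section \<open>From the k-kernel to a Mahler system\<close>

text \<open>Sections compose: k^l (kn + r) + s = k^(l+1) n + (k^l r + s), and the new offset is
  below k^(l+1).\<close>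

lemma section_in_k_kernel:
  assumes "v \<in> k_kernel k f" "r < k"
  shows "(\<lambda>n. v (k * n + r)) \<in> k_kernel k f"
proof -
  obtain l s where v: "v = (\<lambda>n. rat_of_int (f (k ^ l * n + s)))" and s: "s < k ^ l"
    using assms(1) unfolding k_kernel_def by blast
  have "k ^ l * r + s < k ^ l * (r + 1)" using s by simp
  also have "\<dots> \<le> k ^ l * k" using assms(2) by (intro mult_left_mono) auto
  finally have "k ^ l * r + s < k ^ Suc l" by (simp add: mult.commute)
  moreover have "(\<lambda>n. v (k * n + r)) = (\<lambda>n. rat_of_int (f (k ^ Suc l * n + (k ^ l * r + s))))"
    by (simp add: v algebra_simps)
  ultimately show ?thesis unfolding k_kernel_def by blast
qed

lemma sum_fun_apply: "sum h S x = (\<Sum>i\<in>S. h i x)"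
  by (induction S rule: infinite_finite_induct) auto

text \<open>A basis chosen inside the kernel, rather than merely in its span, consists of integer
  sequences whose sections again lie in the kernel and hence have coordinates in the basis.\<close>

lemma k_kernel_basis_recurrence:
  assumes reg: "k_regular k f"
  obtains g :: "nat \<Rightarrow> nat \<Rightarrow> int" and A :: "nat \<Rightarrow> nat \<Rightarrow> nat \<Rightarrow> rat" and u :: "nat \<Rightarrow> rat"
  where "\<And>i r n. i < kernel_dim k f \<Longrightarrow> r < k \<Longrightarrow>
      rat_of_int (g i (k * n + r)) = (\<Sum>j<kernel_dim k f. A r i j * rat_of_int (g j n))"
    and "\<And>n. rat_of_int (f n) = (\<Sum>j<kernel_dim k f. u j * rat_of_int (g j n))"
proof -
  let ?V = "k_kernel k f"
  define L where "L = kernel_dim k f"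
  obtain B where B: "B \<subseteq> ?V" "\<not> rat_seq.dependent B" "?V \<subseteq> rat_seq.span B"
    using rat_seq.maximal_independent_subset[of ?V] by blast
  obtain S where S: "finite S" "rat_seq.span S = rat_seq.span ?V"
    using reg unfolding k_regular_def by blast
  have "B \<subseteq> rat_seq.span S" using B(1) S(2) rat_seq.span_superset by blast
  then have fin: "finite B" using rat_seq.independent_span_bound[OF S(1) B(2)] by blast
  have "rat_seq.span B = rat_seq.span ?V"
    by (rule antisym) (use B rat_seq.span_mono rat_seq.span_minimal rat_seq.subspace_span in blast)+
  then have "rat_seq.dim (rat_seq.span ?V) = card B"
    using B(2) by (intro rat_seq.dim_eq_card) (auto simp: rat_seq.span_span)
  then have card: "card B = L" by (simp add: L_def kernel_dim_def)
  obtain h where h: "bij_betw h {..<L} B"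
    using ex_bij_betw_nat_finite[OF fin] unfolding card atLeast0LessThan by blast
  have coords: "\<exists>w. \<forall>n. v n = (\<Sum>j<L. w j * h j n)" if "v \<in> ?V" for v
  proof -
    have "v \<in> rat_seq.span B" using that B(3) by blast
    then obtain w where "v = (\<Sum>b\<in>B. seq_scale (w b) b)"
      unfolding rat_seq.span_finite[OF fin] by blast
    then have "v n = (\<Sum>b\<in>B. w b * b n)" for n by (simp add: sum_fun_apply seq_scale_def)
    also have "(\<Sum>b\<in>B. w b * b n) = (\<Sum>j<L. w (h j) * h j n)" for n
      by (rule sum.reindex_bij_betw[OF h, symmetric])
    finally have "\<forall>n. v n = (\<Sum>j<L. w (h j) * h j n)" by blast
    then show ?thesis by (rule exI[of _ "\<lambda>j. w (h j)"])
  qed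
  have hV: "h i \<in> ?V" if "i < L" for i using that B(1) h by (auto simp: bij_betw_def)
  define g where "g = (\<lambda>i n. \<lfloor>h i n\<rfloor>)"
  have g: "rat_of_int (g i n) = h i n" if "i < L" for i n
    using hV[OF that] by (auto simp: g_def k_kernel_def)
  define A where "A = (\<lambda>r i. SOME w. \<forall>n. h i (k * n + r) = (\<Sum>j<L. w j * h j n))"
  have A: "\<forall>n. h i (k * n + r) = (\<Sum>j<L. A r i j * h j n)" if "i < L" "r < k" for i r
    unfolding A_def by (rule someI_ex[OF coords[OF section_in_k_kernel[OF hV]]]) (use that in auto)
  have "(\<lambda>n. rat_of_int (f n)) \<in> ?V"
    unfolding k_kernel_def by (rule CollectI, intro exI[of _ 0]) auto
  from coords[OF this] obtain u where u: "\<And>n. rat_of_int (f n) = (\<Sum>j<L. u j * h j n)" by blast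
  show ?thesis
    using that[of g A u] unfolding L_def[symmetric] using A u g by simp
qed

section \<open>Numerical comparison and conclusion\<close>

text \<open>With t = (64k)^L the left side is at most 1 + 2t^2 <= 3t^2 <= 12^t. The bound L >= 1
  enters through k^(L+1) <= k^(2L).\<close>

lemma exponent_bound_le_tower:
  fixes k L :: nat
  assumes "k \<ge> 2" "L \<ge> 1"
  shows "1 + (L + 1) * (L + 2) * k ^ (L + 1) \<le> 39 ^ ((2 ^ 6 * k) ^ L)"
proof -
  define t where "t = (2 ^ 6 * k) ^ L"
  have t: "t \<ge> 1" using assms by (simp add: t_def)
  have L: "L + 1 \<le> 2 ^ L" using less_exp[of L] by linarith
  then have "L + 2 \<le> 2 * 2 ^ L" by simp
  with L have "(L + 1) * (L + 2) \<le> 2 ^ L * (2 * 2 ^ L)" by (rule mult_mono) auto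
  moreover have "k ^ (L + 1) \<le> k ^ L * k ^ L"
    using assms self_le_power[of k L] by simp
  ultimately have "(L + 1) * (L + 2) * k ^ (L + 1) \<le> (2 ^ L * (2 * 2 ^ L)) * (k ^ L * k ^ L)"
    by (rule mult_mono) auto
  also have "\<dots> = 2 * ((2 * k) ^ L * (2 * k) ^ L)" by (simp add: power_mult_distrib)
  also have "\<dots> \<le> 2 * (t * t)"
    unfolding t_def by (intro mult_left_mono mult_mono power_mono) auto
  finally have "1 + (L + 1) * (L + 2) * k ^ (L + 1) \<le> 1 + 2 * (t * t)" by simp
  also have "\<dots> \<le> 3 * (t * t)" using t by simp
  also have "\<dots> \<le> 3 ^ t * (2 ^ t * 2 ^ t)"
    using t self_le_power[of 3 t] less_exp[of t] by (intro mult_mono) auto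
  also have "\<dots> = 12 ^ t" by (simp flip: power_mult_distrib)
  also have "\<dots> \<le> 39 ^ t" by (intro power_mono) auto
  finally show ?thesis by (simp add: t_def)
qed

theorem theorem7p2:
  fixes k L :: nat and f :: "nat \<Rightarrow> int" and a b :: int
  assumes "k \<ge> 2"
    and "k_regular k f"
    and "L = kernel_dim k f"
    and "a \<noteq> 0"
    and "b \<ge> 2"
    and "ln \<bar>real_of_int a\<bar> / ln (real_of_int b) \<in> {0 ..< 1 / (real L + 2)}"
  shows "irrationality_exponent (gen_fun f (real_of_int a / real_of_int b))
           \<le> ereal (39 ^ ((2 ^ 6 * k) ^ L))"
proof -
  obtain g A' u' where
    rec: "\<And>i r n. i < L \<Longrightarrow> r < k \<Longrightarrow>
      rat_of_int (g i (k * n + r)) = (\<Sum>j<L. A' r i j * rat_of_int (g j n))" and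
    f: "\<And>n. rat_of_int (f n) = (\<Sum>j<L. u' j * rat_of_int (g j n))"
    by (rule k_kernel_basis_recurrence[OF assms(2), folded assms(3)]) (rule that)
  show ?thesis
  proof (cases "L = 0")
    case True
    then have "gen_fun f z = 0" for z using f by (simp add: gen_fun_def)
    moreover have "(1 :: ereal) \<le> ereal (39 ^ ((2 ^ 6 * k) ^ L))"
      unfolding one_ereal_def ereal_less_eq by (rule one_le_power) simp
    ultimately show ?thesis using order_trans[OF irrationality_exponent_zero_le] by simp
  next
    case False
    \<comment> \<open>All structure constants and the coordinates of f are collected, so that one
      denominator \<open>D\<close> serves both the matrices and \<open>u\<close>.\<close>
    define S where "S = (\<lambda>(r, i, j). A' r i j) ` ({..<k} \<times> {..<L} \<times> {..<L}) \<union> u' ` {..<L}"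
    have "finite S" by (simp add: S_def)
    then obtain D :: int where D: "D > 0" "\<And>z. z \<in> S \<Longrightarrow> of_int D * z \<in> \<int>"
      using finite_common_denominator by blast
    define A where "A = (\<lambda>r i j. \<lfloor>of_int D * A' r i j\<rfloor>)"
    have A: "rat_of_int (A r i j) = of_int D * A' r i j" if "r < k" "i < L" "j < L" for r i j
    proof -
      have "of_int D * A' r i j \<in> \<int>" using that by (intro D(2)) (force simp: S_def)
      then show ?thesis unfolding A_def by (auto elim!: Ints_cases)
    qed
    interpret mahler_system k L g A D
    proof
      fix i r n assume "i < L" "r < k"
      then have "rat_of_int (D * g i (k * n + r)) = rat_of_int (\<Sum>j<L. A r i j * g j n)"
        by (simp add: rec A sum_distrib_left mult.assoc)
      then show "D * g i (k * n + r) = (\<Sum>j<L. A r i j * g j n)" by (simp only: of_int_eq_iff)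
    qed (use assms(1) D(1) in auto)
    define u where "u = (\<lambda>j. real_of_rat (u' j))"
    have u: "real_of_int D * u j \<in> \<int>" if "j < L" for j
    proof -
      have "of_int D * u' j \<in> \<int>" using that by (intro D(2)) (simp add: S_def)
      then obtain z where "of_int D * u' j = rat_of_int z" by (auto elim: Ints_cases)
      then have "real_of_rat (of_int D * u' j) = real_of_int z" by simp
      then show ?thesis by (simp add: u_def of_rat_mult)
    qed
    have fu: "real_of_int (f n) = (\<Sum>j<L. u j * real_of_int (g j n))" for n
      using arg_cong[OF f[of n], of real_of_rat] by (simp add: u_def of_rat_sum of_rat_mult)
    have ab: "\<bar>a\<bar> ^ (L + 2) < b"
    proof -
      have lb: "ln (real_of_int b) > 0" using assms(5) by simp
      have "ln \<bar>real_of_int a\<bar> / ln (real_of_int b) < 1 / (real L + 2)" using assms(6) by simp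
      then have "real (L + 2) * ln \<bar>real_of_int a\<bar> < ln (real_of_int b)"
        using lb by (simp add: field_simps)
      then have "ln (\<bar>real_of_int a\<bar> ^ (L + 2)) < ln (real_of_int b)"
        using assms(4) by (simp only: ln_realpow zero_less_abs_iff of_int_eq_0_iff)
      then have "\<bar>real_of_int a\<bar> ^ (L + 2) < real_of_int b"
        using assms(4,5) by (subst (asm) ln_less_cancel_iff) auto
      then have "real_of_int (\<bar>a\<bar> ^ (L + 2)) < real_of_int b" by simp
      then show ?thesis by (simp only: of_int_less_iff)
    qed
    \<comment> \<open>Here N - 1 - M = L + 3, so the Pade system has exactly M equations in M + 1
      unknowns. Moreover N - M - 2 = L + 2, while N = (L + 2)^2 gives |a|^N < b^(L+2) from |a|^(L+2)
      < b.\<close>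
    define M where "M = L * (L + 3)"
    define N where "N = (L + 2) * (L + 2)"
    have N: "N = M + 2 + (L + 2)" by (simp add: M_def N_def algebra_simps)
    have "\<bar>a\<bar> \<le> \<bar>a\<bar> ^ (L + 2)" using assms(4) by (intro self_le_power) auto
    with ab have "\<bar>a\<bar> < b" by simp
    have "\<bar>a\<bar> ^ N < b ^ (L + 2)"
      unfolding N_def power_mult using ab by (intro power_strict_mono) auto
    then have small: "\<bar>a\<bar> ^ N * b ^ (M + 2) < b ^ N"
      using assms(5) unfolding N power_add[of b "M + 2"] by (simp add: mult.commute)
    define z where "z = real_of_int a / real_of_int b"
    have "real_of_int \<bar>a\<bar> < real_of_int b" using \<open>\<bar>a\<bar> < b\<close> by (simp only: of_int_less_iff)
    then have z: "\<bar>z\<bar> < 1" using assms(5) by (simp add: z_def)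
    have "(\<lambda>n. \<Sum>j<L. u j * (real_of_int (g j n) * z ^ n)) sums (\<Sum>j<L. u j * G j z)"
      using z by (intro sums_sum sums_mult G_sums) auto
    then have "gen_fun f z = (\<Sum>j<L. u j * G j z)"
      unfolding gen_fun_def by (simp add: fu sum_distrib_right mult.assoc sums_iff)
    then have "irrationality_exponent (gen_fun f z) \<le> ereal (1 + real ((M + 2) * k ^ (L + 1)))"
      unfolding z_def using assms(4,5) small u N
      by (simp only:, intro irrationality_exponent_value_le[of b a M N]) (auto simp: M_def)
    also have "\<dots> \<le> ereal (39 ^ ((2 ^ 6 * k) ^ L))"
    proof -
      have "1 + (M + 2) * k ^ (L + 1) \<le> 39 ^ ((2 ^ 6 * k) ^ L)"
        using exponent_bound_le_tower[of k L] assms(1) False by (simp add: M_def algebra_simps)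
      then have "real (1 + (M + 2) * k ^ (L + 1)) \<le> real (39 ^ ((2 ^ 6 * k) ^ L))"
        by (simp only: of_nat_le_iff)
      then show ?thesis unfolding ereal_less_eq of_nat_add of_nat_1 of_nat_power of_nat_numeral .
    qed
    finally show ?thesis by (simp add: z_def)
  qed
qed

end
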